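(* Let $\dot{x}=f(x,u)$ be a continuous-time system with an equilibrium $(x_s,u_s)$. Suppose that it can be transformed into a structurally flat triangular form (as defined in the context, including its rank conditions) via a state- and input transformation $$\bar{x}=\Phi_x(x),\qquad \bar{u}=\Phi_u(x,u).$$ Let $\dot{\bar{x}}=\bar f(\bar{x},u)$ be the system obtained from $\dot{x}=f(x,u)$ by applying only the state transformation $\bar{x}=\Phi_x(x)$, keeping the original input $u$. Then, for sufficiently small sampling time $T_s>0$, the implicit Euler-discretization $$\bar{x}^{+}=\bar{x}+T_s\bar f(\bar{x}^{+},u)$$ (in its explicit state representation $\bar x^{+}=\tilde f(\bar x,u)$ in a neighborhood of the equilibrium $(\Phi_x(x_s),u_s)$) is flat.
   Context: All functions are smooth, and all statements are local around the equilibrium $(x_s,u_s)$, $f(x_s,u_s)=0$, and its images under the transformations. $\dim(x)=n$, $\dim(u)=m$; a superscript $+$ denotes the forward-shift. A state- and input transformation is a pair of smooth maps $\bar x=\Phi_x(x)$, $\bar u=\Phi_u(x,u)$ with $\dim(\bar x)=n$, $\dim(\bar u)=m$, where $\Phi_x$ is (locally) a diffeomorphism and $\Phi_u$ is, for fixed $x$, (locally) smoothly invertible with respect to $u$. **Structurally flat triangular form.** A continuous-time system with state $\bar x$ and input $\bar u$ is in structurally flat triangular form if it is decomposed into $p$ subsystems $$\begin{aligned}\dot{\bar x}_{p} &= f_{p}(\bar x_{p},\bar x_{p-1},\bar u_{p-1})\\ \dot{\bar x}_{p-1} &= f_{p-1}(\bar x_{p},\bar x_{p-1},\bar x_{p-2},\bar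 u_{p-1},\bar u_{p-2})\\ &\ \vdots\\ \dot{\bar x}_{2} &= f_{2}(\bar x_{p},\dots,\bar x_{1},\bar u_{p-1},\dots,\bar u_{1})\\ \dot{\bar x}_{1} &= f_{1}(\bar x_{p},\dots,\bar x_{1},\bar u_{p-1},\dots,\bar u_{1},\bar u_{0})\end{aligned}$$ (i.e. for $k\ge 2$, $f_k$ depends only on $\bar x_p,\dots,\bar x_{k-1},\bar u_{p-1},\dots,\bar u_{k-1}$), where each $\bar x_k$ and $\bar u_k$ is a block of variables, $\dim(\bar x_k)=\dim(f_k)\ge 1$, the state is $$\bar x=(\bar x_{p},\bar x_{p-1},\dots,\bar x_{1})=(y_{p},(y_{p-1},\hat{x}_{p-1}),\dots,(y_{1},\hat{x}_{1})),$$ i.e. $\bar x_p=y_p$ and $\bar x_k=(y_k,\hat x_k)$ for $k=1,\dots,p-1$, the input is $\bar u=(\bar u_{p-1},\dots,\bar u_0)$ (components $y_k$ and/or $\bar u_k$ may be empty), and the following rank conditions hold: $$\mathrm{rank}(\partial_{\bar u_{0}}f_{1})=\dim(f_{1})=\dim(\bar u_{0}),\qquad \mathrm{rank}(\partial_{(\hat{x}_{k},\bar u_{k})}f_{k+1})=\dim(f_{k+1})=\dim((\hat{x}_{k},\bar u_{k})),\quad k=1,\dots,p-1.$$ **State representation.** A state representation of $\bar x^{+}=\bar x+T_s \bar f(\bar x^{+},u)$ near an equilibrium $(\bar x_s,u_s)$ is a smooth map $\tilde f$ defined near $(\bar x_s,u_s)$ such that, for $(\bar x,u)$ near $(\bar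 x_s,u_s)$ and $\bar x^+$ near $\bar x_s$, $\bar x^{+}=\bar x+T_s \bar f(\bar x^{+},u)$ is equivalent to $\bar x^{+}=\tilde f(\bar x,u)$. It exists for all sufficiently small $T_s>0$. **Discrete-time flatness.** A discrete-time system $\bar x^{+}=\tilde f(\bar x,u)$ whose Jacobian satisfies the submersivity condition $\mathrm{rank}(\partial_{(\bar x,u)}\tilde f)=n$ is flat if there is a one-to-one correspondence between its trajectories $(\bar x(k),u(k))$ and trajectories $y(k)$, $\dim(y)=m$, of a trivial system (arbitrary sequences that need not satisfy any difference equation), expressed by two smooth maps $$(\bar x(k),u(k))=F(y(k-r_1),\dots,y(k+r_2)),$$ $$y(k)=\varphi(\bar x(k-q_1),u(k-q_1),\dots,\bar x(k+q_2),u(k+q_2))$$ with some integers $r_1,r_2,q_1,q_2\ge 0$, such that: substituting the first map (and its shift for $\bar x(k+1)$) into $\bar x(k+1)=\tilde f(\bar x(k),u(k))$ yields an identity in the arbitrary sequence $y$; composing $\varphi$ with the occurring shifts of $F$ yields the identity $y(k)=y(k)$; and composing $F$ with the occurring shifts of $\varphi$ yields the identity $(\bar x(k),u(k))=(\bar x(k),u(k))$ along all trajectories of the system. Here flatness is understood locally: the maps are defined near the values corresponding to the equilibrium, and the trajectories remain sufficiently close to the equilibrium. *)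

theory Defs
  imports "HOL-Analysis.Analysis"
begin

text \<open>Smoothness on open subsets of finite-dimensional spaces. In finite dimension, continuity of
  all directional derivatives \<open>x \<mapsto> Df(x) v\<close> is the same as continuity of \<open>Df\<close>.\<close>

primrec Ck_on :: "nat \<Rightarrow> 'a::real_normed_vector set \<Rightarrow> ('a \<Rightarrow> 'b::real_normed_vector) \<Rightarrow> bool" where
  "Ck_on 0 S f \<longleftrightarrow> continuous_on S f"
| "Ck_on (Suc k) S f \<longleftrightarrow> continuous_on S f \<and> (\<forall>x\<in>S. f differentiable (at x)) \<and>
     (\<forall>v. Ck_on k S (\<lambda>x. frechet_derivative f (at x) v))"

definition smooth_on :: "'a::real_normed_vector set \<Rightarrow> ('a \<Rightarrow> 'b::real_normed_vector) \<Rightarrow> bool" where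
  "smooth_on S f \<longleftrightarrow> (\<forall>k. Ck_on k S f)"

definition smooth_near :: "'a::real_normed_vector \<Rightarrow> ('a \<Rightarrow> 'b::real_normed_vector) \<Rightarrow> bool" where
  "smooth_near x f \<longleftrightarrow> (\<exists>S. open S \<and> x \<in> S \<and> smooth_on S f)"

definition local_diffeo_at :: "'a::real_normed_vector \<Rightarrow> ('a \<Rightarrow> 'b::real_normed_vector) \<Rightarrow> bool" where
  "local_diffeo_at x \<Phi> \<longleftrightarrow> (\<exists>S T \<Psi>. open S \<and> open T \<and> x \<in> S \<and> homeomorphism S T \<Phi> \<Psi> \<and>
     smooth_on S \<Phi> \<and> smooth_on T \<Psi>)"


text \<open>Smooth functions of a finite window \<open>(w i)\<close>, \<open>i \<in> I\<close>, of a sequence. The length of a window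
  is not known in advance, so a window is represented by a whole family \<open>w\<close> of which only
  the entries with index in \<open>I\<close> matter. Function types carry no norm; smoothness is therefore
  expressed by existence and continuity (product topology) of all iterated partial derivatives with
  respect to the single entries \<open>w i\<close>.\<close>

primrec window_Ck_on ::
  "nat \<Rightarrow> 'i set \<Rightarrow> ('i \<Rightarrow> 'a::real_normed_vector) set \<Rightarrow> (('i \<Rightarrow> 'a) \<Rightarrow> 'b::real_normed_vector) \<Rightarrow> bool"
where
  "window_Ck_on 0 I W g \<longleftrightarrow> continuous_on W g"
| "window_Ck_on (Suc k) I W g \<longleftrightarrow> continuous_on W g \<and>
     (\<forall>i\<in>I. \<forall>w\<in>W. (\<lambda>z. g (w(i := z))) differentiable (at (w i))) \<and>
     (\<forall>i\<in>I. \<forall>v. window_Ck_on k I W (\<lambda>w. frechet_derivative (\<lambda>z. g (w(i := z))) (at (w i)) v))"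

definition smooth_window_on ::
  "'i set \<Rightarrow> 'a::real_normed_vector set \<Rightarrow> (('i \<Rightarrow> 'a) \<Rightarrow> 'b::real_normed_vector) \<Rightarrow> bool" where
  "smooth_window_on I A g \<longleftrightarrow>
     (let W = {w. \<forall>i\<in>I. w i \<in> A} in
        (\<forall>w\<in>W. \<forall>w'\<in>W. (\<forall>i\<in>I. w i = w' i) \<longrightarrow> g w = g w') \<and>
        (\<forall>k. window_Ck_on k I W g))"


definition jac :: "((real^'n) \<times> (real^'m) \<Rightarrow> real^'l) \<Rightarrow> (real^'n) \<times> (real^'m) \<Rightarrow> real^('n + 'm)^'l" where
  "jac g z = (\<chi> i j. frechet_derivative g (at z)
      (case j of Inl a \<Rightarrow> (axis a 1, 0) | Inr b \<Rightarrow> (0, axis b 1)) $ i)"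

text \<open>Rank of the submatrix with rows \<open>R\<close> and columns \<open>C\<close>; padding by zeros does not change it.\<close>

definition sub_rank :: "'i::finite set \<Rightarrow> 'j::finite set \<Rightarrow> real^'j^'i \<Rightarrow> nat" where
  "sub_rank R C A = rank (\<chi> i j. if i \<in> R \<and> j \<in> C then A $ i $ j else 0)"


text \<open>\<open>x' = g(x, u)\<close> arises from \<open>x' = f(x, u)\<close> through the new state \<open>\<Phi>x x\<close> and the new
  input \<open>\<Phi>u (x, u)\<close>: \<open>g(\<Phi>x x, \<Phi>u (x, u)) = D\<Phi>x(x) f(x, u)\<close>. For a local diffeomorphism
  \<open>\<Phi>x\<close> and a \<open>\<Phi>u\<close> that is locally invertible in \<open>u\<close> this determines \<open>g\<close> near the image of the
  base point. The choice \<open>\<Phi>u = snd\<close> keeps the input.\<close>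

definition transformed_system ::
  "(real^'n \<Rightarrow> real^'n) \<Rightarrow> ((real^'n) \<times> (real^'m) \<Rightarrow> real^'m) \<Rightarrow> ((real^'n) \<times> (real^'m) \<Rightarrow> real^'n) \<Rightarrow>
   (real^'n) \<times> (real^'m) \<Rightarrow> ((real^'n) \<times> (real^'m) \<Rightarrow> real^'n) \<Rightarrow> bool" where
  "transformed_system \<Phi>x \<Phi>u f z0 g \<longleftrightarrow>
     (\<forall>\<^sub>F z in nhds z0. g (\<Phi>x (fst z), \<Phi>u z) = frechet_derivative \<Phi>x (at (fst z)) (f z))"

definition state_input_transformation ::
  "(real^'n \<Rightarrow> real^'n) \<Rightarrow> ((real^'n) \<times> (real^'m) \<Rightarrow> real^'m) \<Rightarrow> (real^'n) \<times> (real^'m) \<Rightarrow> bool" where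
  "state_input_transformation \<Phi>x \<Phi>u z0 \<longleftrightarrow>
     local_diffeo_at (fst z0) \<Phi>x \<and> smooth_near z0 \<Phi>u \<and>
     (\<forall>\<^sub>F z in nhds z0. local_diffeo_at (snd z) (\<lambda>u. \<Phi>u (fst z, u)))"


text \<open>The decomposition into blocks is given by labels: state component \<open>i\<close> belongs to the
  block \<open>bx i \<in> {1..p}\<close>, input component \<open>j\<close> to the block \<open>bu j \<in> {0..p - 1}\<close>, and \<open>H\<close> collects the
  state components that belong to the hat parts of the state blocks (so \<open>y\<^sub>k\<close> consists of the components
  of block \<open>k\<close> outside \<open>H\<close>). The first rank condition is the case \<open>k = 0\<close> below, since no
  state component has label 0; likewise the dependency condition is void for block 1.\<close>

definition flat_triangular_blocks ::
  "nat \<Rightarrow> ('n::finite \<Rightarrow> nat) \<Rightarrow> ('m::finite \<Rightarrow> nat) \<Rightarrow> 'n set \<Rightarrow>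
   ((real^'n) \<times> (real^'m) \<Rightarrow> real^'n) \<Rightarrow> (real^'n) \<times> (real^'m) \<Rightarrow> bool" where
  "flat_triangular_blocks p bx bu H g z0 \<longleftrightarrow>
     (\<forall>i. 1 \<le> bx i \<and> bx i \<le> p) \<and> (\<forall>j. bu j < p) \<and>
     (\<forall>k\<in>{1..p}. \<exists>i. bx i = k) \<and>
     (\<forall>i\<in>H. bx i < p) \<and>
     (\<exists>U. open U \<and> z0 \<in> U \<and>
        (\<forall>i. \<forall>(x, u)\<in>U. \<forall>(x', u')\<in>U.
           (\<forall>j. bx i \<le> bx j + 1 \<longrightarrow> x $ j = x' $ j) \<longrightarrow>
           (\<forall>j. bx i \<le> bu j + 1 \<longrightarrow> u $ j = u' $ j) \<longrightarrow>
           g (x, u) $ i = g (x', u') $ i) \<and>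
        (\<forall>k<p. let R = {i. bx i = k + 1};
                   C = Inl ` {i\<in>H. bx i = k} \<union> Inr ` {j. bu j = k}
               in card C = card R \<and> (\<forall>z\<in>U. sub_rank R C (jac g z) = card R)))"

definition structurally_flat_triangular ::
  "((real^'n) \<times> (real^'m) \<Rightarrow> real^'n) \<Rightarrow> (real^'n) \<times> (real^'m) \<Rightarrow> bool" where
  "structurally_flat_triangular g z0 \<longleftrightarrow>
     smooth_near z0 g \<and> (\<exists>p bx bu H. flat_triangular_blocks p bx bu H g z0)"


definition state_representation ::
  "real \<Rightarrow> ((real^'n) \<times> (real^'m) \<Rightarrow> real^'n) \<Rightarrow> (real^'n) \<times> (real^'m) \<Rightarrow>
   ((real^'n) \<times> (real^'m) \<Rightarrow> real^'n) \<Rightarrow> bool" where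
  "state_representation Ts g z0 h \<longleftrightarrow>
     (\<exists>U V. open U \<and> z0 \<in> U \<and> open V \<and> fst z0 \<in> V \<and> smooth_on U h \<and>
        (\<forall>(x, u)\<in>U. \<forall>x'\<in>V. x' = x + Ts *\<^sub>R g (x', u) \<longleftrightarrow> x' = h (x, u)))"


text \<open>Local flatness of \<open>x(k + 1) = h(x(k), u(k))\<close> around the equilibrium \<open>z0\<close>. All closeness
  requirements use one radius \<open>\<delta>\<close>, which may be decreased without affecting any of the clauses; as
  \<open>F\<close> and \<open>\<phi>\<close> are continuous, for small \<open>\<delta>\<close> all compositions take place where the maps
  are smooth. Each identity at time \<open>k\<close> involves finitely many time steps only, so closeness to the
  equilibrium and the system equation are required only on these; in particular the
  identities hold along all sequences on \<open>\<int>\<close> that stay \<open>\<delta>\<close>-close to the equilibrium.\<close>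

definition discrete_flat_at ::
  "((real^'n) \<times> (real^'m) \<Rightarrow> real^'n) \<Rightarrow> (real^'n) \<times> (real^'m) \<Rightarrow> bool" where
  "discrete_flat_at h z0 \<longleftrightarrow>
     (\<forall>\<^sub>F z in nhds z0. rank (jac h z) = CARD('n)) \<and>
     (\<exists>(r1::nat) (r2::nat) (q1::nat) (q2::nat)
        (F :: (int \<Rightarrow> real^'m) \<Rightarrow> (real^'n) \<times> (real^'m))
        (\<phi> :: (int \<Rightarrow> (real^'n) \<times> (real^'m)) \<Rightarrow> real^'m) y0 \<delta>.
        \<delta> > 0 \<and>
        smooth_window_on {- int r1..int r2} (ball y0 \<delta>) F \<and> F (\<lambda>_. y0) = z0 \<and>
        smooth_window_on {- int q1..int q2} (ball z0 \<delta>) \<phi> \<and> \<phi> (\<lambda>_. z0) = y0 \<and>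
        (\<forall>y k. (\<forall>j\<in>{k - int r1..k + int r2 + 1}. y j \<in> ball y0 \<delta>) \<longrightarrow>
           fst (F (\<lambda>i. y (k + 1 + i))) = h (F (\<lambda>i. y (k + i)))) \<and>
        (\<forall>y k. (\<forall>j\<in>{k - int q1 - int r1..k + int q2 + int r2}. y j \<in> ball y0 \<delta>) \<longrightarrow>
           \<phi> (\<lambda>i. F (\<lambda>j. y (k + i + j))) = y k) \<and>
        (\<forall>z k. (\<forall>j\<in>{k - int r1 - int q1..k + int r2 + int q2}. z j \<in> ball z0 \<delta>) \<longrightarrow>
           (\<forall>j\<in>{k - int r1 - int q1..<k + int r2 + int q2}. fst (z (j + 1)) = h (z j)) \<longrightarrow>
           F (\<lambda>i. \<phi> (\<lambda>j. z (k + i + j))) = z k))"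

end

theory Submission
  imports Defs
begin

text \<open>Near the equilibrium, the system with the original input is \<open>x' = fbar (x, u)\<close>, where
\<open>fbar (x, u) = g (x, \<theta> (x, u))\<close> for the triangular system \<open>g\<close> and a map \<open>\<theta>\<close> that is locally invertible in
\<open>u\<close>. The flat output is \<open>y = \<pi> x\<close>, the components of \<open>x\<close> outside the hat parts \<open>H\<close>; the rank conditions
count dimensions such that there are exactly \<open>m\<close> of them (\<open>card_flat_output\<close>).

Suppose that the values \<open>d = fbar (x, u)\<close> and \<open>y = \<pi> x\<close> are known. Since \<open>g\<close> is triangular, the equations
of block \<open>p\<close> determine the hat part of block \<open>p - 1\<close> of \<open>x\<close> together with block \<open>p - 1\<close> of the transformed
input, the equations of block \<open>p - 1\<close> then determine block \<open>p - 2\<close>, and so on down to block \<open>0\<close>. On the level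
of derivatives this says that \<open>(x, u) \<mapsto> (fbar (x, u), \<pi> x)\<close> has an injective derivative, hence a smooth
local inverse \<open>N\<close>. Moreover, the blocks \<open>\<ge> k\<close> of the state component of \<open>N (d, y)\<close> depend only on
the blocks \<open>\<ge> k + 1\<close> of \<open>d\<close>, and on \<open>y\<close> (\<open>triangular_kernel\<close>, \<open>flat_output_chart\<close>).

The implicit Euler step from \<open>t - 1\<close> to \<open>t\<close> evaluates \<open>fbar\<close> at the new state \<open>x t\<close> and the old input
\<open>u (t - 1)\<close>. It is therefore equivalent to \<open>(x t, u (t - 1)) = N ((x t - x (t - 1)) / Ts, y t)\<close>. The
state component of this equation is a fixed point equation for the sequence \<open>x\<close>, given \<open>y\<close>. Because of the
shift by one block, each iteration starting from the constant equilibrium sequence makes one more block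
correct, and after \<open>p\<close> iterations all of \<open>x t\<close> is obtained as a smooth function of
\<open>y (t - p + 1), \<dots>, y t\<close> (\<open>flat_state\<close>, \<open>iteration_agreement\<close>). The input component then gives
\<open>u (t - 1)\<close>.

The analytic tools are the closure of the smooth functions of a window under composition, and a smooth
inverse function theorem (\<open>window_Ck_on_compose\<close>, \<open>smooth_inverse_function\<close>). The latter also provides
a state representation for small \<open>Ts\<close>; the flatness argument works with the Euler equation, which every state
representation satisfies near the equilibrium.\<close>

section \<open>Smooth functions of windows\<close>

text \<open>The partial derivatives in the definition of \<open>window_Ck_on\<close> see \<open>W\<close> only along single entries, so openness
along each entry in \<open>I\<close> is the natural domain condition: it makes these derivatives depend only on the values
of the function on \<open>W\<close>.\<close>

definition window_open :: "'i set \<Rightarrow> ('i \<Rightarrow> 'a::real_normed_vector) set \<Rightarrow> bool" where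
  "window_open I W \<longleftrightarrow> (\<forall>i\<in>I. \<forall>w\<in>W. \<forall>\<^sub>F z in nhds (w i). w(i := z) \<in> W)"

lemma window_open_entries:
  assumes "open A"
  shows "window_open I {w. \<forall>i\<in>I. w i \<in> A}"
  unfolding window_open_def
proof (intro ballI)
  fix i w assume "i \<in> I" "w \<in> {w. \<forall>i\<in>I. w i \<in> A}"
  then have "\<forall>\<^sub>F z in nhds (w i). z \<in> A"
    using assms by (auto intro: eventually_nhds_in_open)
  then show "\<forall>\<^sub>F z in nhds (w i). w(i := z) \<in> {w. \<forall>i\<in>I. w i \<in> A}"
    by eventually_elim (use \<open>w \<in> _\<close> in auto)
qed

lemma window_Ck_on_continuous: "window_Ck_on k I W g \<Longrightarrow> continuous_on W g"
  by (cases k) auto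

lemma window_Ck_on_cong:
  assumes W: "window_open I W" and eq: "\<And>w. w \<in> W \<Longrightarrow> f w = g w"
    and f: "window_Ck_on k I W f"
  shows "window_Ck_on k I W g"
  using eq f
proof (induction k arbitrary: f g)
  case 0
  then show ?case by (simp cong: continuous_on_cong)
next
  case (Suc k)
  have der: "((\<lambda>z. g (w(i := z))) has_derivative D) (at (w i))"
    if "i \<in> I" "w \<in> W" "((\<lambda>z. f (w(i := z))) has_derivative D) (at (w i))" for i w D
  proof -
    have ev: "\<forall>\<^sub>F z in nhds (w i). w(i := z) \<in> W"
      using W that by (auto simp: window_open_def)
    then obtain S where S: "open S" "w i \<in> S" "\<And>z. z \<in> S \<Longrightarrow> w(i := z) \<in> W"
      unfolding eventually_nhds by blast
    show ?thesis
      by (rule has_derivative_transform_within_open[OF that(3) S(1,2)]) (rule Suc.prems(1)[OF S(3)])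
  qed
  have fD: "((\<lambda>z. f (w(i := z))) has_derivative frechet_derivative (\<lambda>z. f (w(i := z))) (at (w i))) (at (w i))"
    if "i \<in> I" "w \<in> W" for i w
    using Suc.prems(2) that by (auto simp: frechet_derivative_works)
  have feq: "frechet_derivative (\<lambda>z. f (w(i := z))) (at (w i)) = frechet_derivative (\<lambda>z. g (w(i := z))) (at (w i))"
    if "i \<in> I" "w \<in> W" for i w
    using frechet_derivative_at[OF der[OF that fD[OF that]]] by simp
  have "continuous_on W g"
    using Suc.prems by (simp cong: continuous_on_cong)
  moreover have "(\<lambda>z. g (w(i := z))) differentiable (at (w i))" if "i \<in> I" "w \<in> W" for i w
    using der[OF that fD[OF that]] by (rule differentiableI)
  moreover have "window_Ck_on k I W (\<lambda>w. frechet_derivative (\<lambda>z. g (w(i := z))) (at (w i)) v)"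
    if "i \<in> I" for i v
  proof (rule Suc.IH)
    show "window_Ck_on k I W (\<lambda>w. frechet_derivative (\<lambda>z. f (w(i := z))) (at (w i)) v)"
      using Suc.prems(2) that by simp
  qed (simp only: feq[OF that])
  ultimately show ?case by simp
qed

text \<open>Introduction and elimination of \<open>window_Ck_on (Suc k)\<close> with an arbitrary family of partial derivatives in
place of \<open>frechet_derivative\<close>; they carry the inductions over \<open>k\<close> for the closure properties below.\<close>

lemma window_Ck_on_SucI:
  assumes W: "window_open I W" and "continuous_on W g"
    and der: "\<And>i w. i \<in> I \<Longrightarrow> w \<in> W \<Longrightarrow> ((\<lambda>z. g (w(i := z))) has_derivative D i w) (at (w i))"
    and D: "\<And>i v. i \<in> I \<Longrightarrow> window_Ck_on k I W (\<lambda>w. D i w v)"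
  shows "window_Ck_on (Suc k) I W g"
proof -
  have "window_Ck_on k I W (\<lambda>w. frechet_derivative (\<lambda>z. g (w(i := z))) (at (w i)) v)" if "i \<in> I" for i v
    by (rule window_Ck_on_cong[OF W _ D[OF that, of v]])
       (simp add: frechet_derivative_at[OF der[OF that]])
  moreover have "(\<lambda>z. g (w(i := z))) differentiable (at (w i))" if "i \<in> I" "w \<in> W" for i w
    using der[OF that] by (rule differentiableI)
  ultimately show ?thesis using assms(2) by simp
qed

lemma window_Ck_on_SucE:
  assumes "window_Ck_on (Suc k) I W g"
  obtains D where "\<And>i w. i \<in> I \<Longrightarrow> w \<in> W \<Longrightarrow> ((\<lambda>z. g (w(i := z))) has_derivative D i w) (at (w i))"
    and "\<And>i v. i \<in> I \<Longrightarrow> window_Ck_on k I W (\<lambda>w. D i w v)"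
proof
  fix i w assume "i \<in> I" "w \<in> W"
  then show "((\<lambda>z. g (w(i := z))) has_derivative frechet_derivative (\<lambda>z. g (w(i := z))) (at (w i))) (at (w i))"
    using assms by (auto simp: frechet_derivative_works)
next
  fix i v assume "i \<in> I"
  then show "window_Ck_on k I W (\<lambda>w. frechet_derivative (\<lambda>z. g (w(i := z))) (at (w i)) v)"
    using assms by simp
qed

lemma window_Ck_on_Suc_imp: "window_Ck_on (Suc k) I W g \<Longrightarrow> window_Ck_on k I W g"
  by (induction k arbitrary: g) auto

lemma window_Ck_on_const:
  assumes W: "window_open I W"
  shows "window_Ck_on k I W (\<lambda>w. c)"
proof (induction k arbitrary: c)
  case (Suc k)
  show ?case
    by (rule window_Ck_on_SucI[OF W, where D = "\<lambda>i w v. 0"]) (auto intro: Suc)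
qed simp

lemma window_Ck_on_bounded_linear:
  assumes W: "window_open I W" and L: "bounded_linear L" and "window_Ck_on k I W g"
  shows "window_Ck_on k I W (\<lambda>w. L (g w))"
  using assms(3)
proof (induction k arbitrary: g)
  case 0
  then show ?case using bounded_linear.continuous_on[OF L] by auto
next
  case (Suc k)
  obtain D where D: "\<And>i w. i \<in> I \<Longrightarrow> w \<in> W \<Longrightarrow> ((\<lambda>z. g (w(i := z))) has_derivative D i w) (at (w i))"
    "\<And>i v. i \<in> I \<Longrightarrow> window_Ck_on k I W (\<lambda>w. D i w v)"
    using window_Ck_on_SucE[OF Suc.prems] by blast
  show ?case
  proof (rule window_Ck_on_SucI[OF W, where D = "\<lambda>i w v. L (D i w v)"])
    show "continuous_on W (\<lambda>w. L (g w))"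
      by (rule bounded_linear.continuous_on[OF L window_Ck_on_continuous[OF Suc.prems]])
  qed (rule Suc.IH bounded_linear.has_derivative[OF L] D | assumption)+
qed

lemma window_Ck_on_add:
  assumes W: "window_open I W" and "window_Ck_on k I W f" "window_Ck_on k I W g"
  shows "window_Ck_on k I W (\<lambda>w. f w + g w)"
  using assms(2,3)
proof (induction k arbitrary: f g)
  case 0
  then show ?case by (auto intro: continuous_intros)
next
  case (Suc k)
  obtain D where D: "\<And>i w. i \<in> I \<Longrightarrow> w \<in> W \<Longrightarrow> ((\<lambda>z. f (w(i := z))) has_derivative D i w) (at (w i))"
    "\<And>i v. i \<in> I \<Longrightarrow> window_Ck_on k I W (\<lambda>w. D i w v)"
    using window_Ck_on_SucE[OF Suc.prems(1)] by blast
  obtain E where E: "\<And>i w. i \<in> I \<Longrightarrow> w \<in> W \<Longrightarrow> ((\<lambda>z. g (w(i := z))) has_derivative E i w) (at (w i))"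
    "\<And>i v. i \<in> I \<Longrightarrow> window_Ck_on k I W (\<lambda>w. E i w v)"
    using window_Ck_on_SucE[OF Suc.prems(2)] by blast
  show ?case
  proof (rule window_Ck_on_SucI[OF W, where D = "\<lambda>i w v. D i w v + E i w v"])
    show "continuous_on W (\<lambda>w. f w + g w)"
      using Suc.prems by (intro continuous_on_add window_Ck_on_continuous)
  qed (rule Suc.IH has_derivative_add D E | assumption)+
qed

lemma window_Ck_on_sum:
  assumes W: "window_open I W" and "\<And>a. a \<in> X \<Longrightarrow> window_Ck_on k I W (f a)"
  shows "window_Ck_on k I W (\<lambda>w. \<Sum>a\<in>X. f a w)"
  using assms(2)
  by (induction X rule: infinite_finite_induct)
     (auto intro: window_Ck_on_const[OF W] window_Ck_on_add[OF W])

lemma window_Ck_on_diff: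
  assumes W: "window_open I W" and "window_Ck_on k I W f" "window_Ck_on k I W g"
  shows "window_Ck_on k I W (\<lambda>w. f w - g w)"
  using window_Ck_on_add[OF W assms(2) window_Ck_on_bounded_linear[OF W _ assms(3), of uminus]]
  by (simp add: bounded_linear_minus[OF bounded_linear_ident])

lemma window_Ck_on_Pair:
  assumes W: "window_open I W" and "window_Ck_on k I W f" "window_Ck_on k I W g"
  shows "window_Ck_on k I W (\<lambda>w. (f w, g w))"
  using window_Ck_on_add[OF W
      window_Ck_on_bounded_linear[OF W bounded_linear_Pair[OF bounded_linear_ident bounded_linear_zero] assms(2)]
      window_Ck_on_bounded_linear[OF W bounded_linear_Pair[OF bounded_linear_zero bounded_linear_ident] assms(3)]]
  by simp

lemma window_Ck_on_scaleR:
  assumes W: "window_open I W" and "window_Ck_on k I W f" "window_Ck_on k I W g"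
  shows "window_Ck_on k I W (\<lambda>w. f w *\<^sub>R g w)"
  using assms(2,3)
proof (induction k arbitrary: f g)
  case 0
  then show ?case by (auto intro: continuous_intros)
next
  case (Suc k)
  obtain D where D: "\<And>i w. i \<in> I \<Longrightarrow> w \<in> W \<Longrightarrow> ((\<lambda>z. f (w(i := z))) has_derivative D i w) (at (w i))"
    "\<And>i v. i \<in> I \<Longrightarrow> window_Ck_on k I W (\<lambda>w. D i w v)"
    using window_Ck_on_SucE[OF Suc.prems(1)] by blast
  obtain E where E: "\<And>i w. i \<in> I \<Longrightarrow> w \<in> W \<Longrightarrow> ((\<lambda>z. g (w(i := z))) has_derivative E i w) (at (w i))"
    "\<And>i v. i \<in> I \<Longrightarrow> window_Ck_on k I W (\<lambda>w. E i w v)"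
    using window_Ck_on_SucE[OF Suc.prems(2)] by blast
  have der: "((\<lambda>z. f (w(i := z)) *\<^sub>R g (w(i := z))) has_derivative
      (\<lambda>v. f w *\<^sub>R E i w v + D i w v *\<^sub>R g w)) (at (w i))" if "i \<in> I" "w \<in> W" for i w
    using has_derivative_scaleR[OF D(1)[OF that] E(1)[OF that]] unfolding fun_upd_triv .
  show ?case
  proof (rule window_Ck_on_SucI[OF W, where D = "\<lambda>i w v. f w *\<^sub>R E i w v + D i w v *\<^sub>R g w"])
    show "continuous_on W (\<lambda>w. f w *\<^sub>R g w)"
      using Suc.prems by (intro continuous_on_scaleR window_Ck_on_continuous)
  qed (rule der Suc.IH window_Ck_on_add[OF W] D E Suc.prems[THEN window_Ck_on_Suc_imp] | assumption)+
qed

lemma window_Ck_on_entry: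
  assumes W: "window_open I W"
  shows "window_Ck_on k I W (\<lambda>w. w j)"
proof (cases k)
  case 0
  then show ?thesis by (auto intro: continuous_on_subset[OF continuous_on_product_coordinates])
next
  case (Suc l)
  have "continuous_on W (\<lambda>w. w j)"
    by (auto intro: continuous_on_subset[OF continuous_on_product_coordinates])
  moreover have "((\<lambda>z. (w(i := z)) j) has_derivative (\<lambda>v. if i = j then v else 0)) (at (w i))" for i w
    by (cases "i = j") auto
  ultimately show ?thesis unfolding Suc
    by (rule window_Ck_on_SucI[OF W]) (rule window_Ck_on_const[OF W])
qed

lemma Ck_on_continuous: "Ck_on k S f \<Longrightarrow> continuous_on S f"
  by (cases k) auto

lemma bounded_linear_basis_expansion:
  fixes L :: "'a::euclidean_space \<Rightarrow> 'b::real_normed_vector"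
  assumes "bounded_linear L"
  shows "L v = (\<Sum>e\<in>Basis. (v \<bullet> e) *\<^sub>R L e)"
proof -
  interpret bounded_linear L by fact
  show ?thesis by (subst euclidean_representation[symmetric]) (simp add: sum scaleR)
qed

text \<open>The chain rule gives \<open>Df (g w) (D\<^sub>i g w v)\<close> as partial derivative, which is not a composition of two
functions. Expanding \<open>D\<^sub>i g w v\<close> in a basis turns it into a sum of products of the scalar functions
\<open>D\<^sub>i g w v \<bullet> e\<close> with the compositions \<open>Df (g w) e\<close>, to which the induction hypothesis applies.\<close>

lemma window_Ck_on_compose:
  fixes f :: "'a::euclidean_space \<Rightarrow> 'b::real_normed_vector"
  assumes W: "window_open I W" and "Ck_on k S f" and "window_Ck_on k I W g"
    and gS: "\<And>w. w \<in> W \<Longrightarrow> g w \<in> S"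
  shows "window_Ck_on k I W (\<lambda>w. f (g w))"
  using assms(2,3)
proof (induction k arbitrary: f)
  case 0
  then show ?case using gS by (auto intro: continuous_on_compose2)
next
  case (Suc k)
  note gk = window_Ck_on_Suc_imp[OF Suc.prems(2)]
  obtain D where D: "\<And>i w. i \<in> I \<Longrightarrow> w \<in> W \<Longrightarrow> ((\<lambda>z. g (w(i := z))) has_derivative D i w) (at (w i))"
    "\<And>i v. i \<in> I \<Longrightarrow> window_Ck_on k I W (\<lambda>w. D i w v)"
    using window_Ck_on_SucE[OF Suc.prems(2)] by blast
  have fD: "(f has_derivative frechet_derivative f (at x)) (at x)" if "x \<in> S" for x
    using Suc.prems(1) that by (auto simp: frechet_derivative_works)
  have cont: "continuous_on W (\<lambda>w. f (g w))"
    using continuous_on_compose2[OF Ck_on_continuous[OF Suc.prems(1)] window_Ck_on_continuous[OF Suc.prems(2)]] gS by auto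
  define E where "E i w v = (\<Sum>e\<in>Basis. (D i w v \<bullet> e) *\<^sub>R frechet_derivative f (at (g w)) e)" for i w v
  have E: "E i w v = frechet_derivative f (at (g w)) (D i w v)" if "w \<in> W" for i w v
    unfolding E_def
    by (rule bounded_linear_basis_expansion[OF has_derivative_bounded_linear[OF fD[OF gS[OF that]]], symmetric])
  have der: "((\<lambda>z. f (g (w(i := z)))) has_derivative E i w) (at (w i))" if "i \<in> I" "w \<in> W" for i w
    using has_derivative_compose[OF D(1)[OF that], of f "frechet_derivative f (at (g w))"] fD[OF gS[OF that(2)]]
    by (simp add: E[OF that(2), abs_def])
  have "window_Ck_on k I W (\<lambda>w. frechet_derivative f (at (g w)) e)" for e
    by (rule Suc.IH) (use Suc.prems(1) gk in auto)
  then have "window_Ck_on k I W (\<lambda>w. E i w v)" if "i \<in> I" for i v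
    unfolding E_def using D(2)[OF that]
    by (intro window_Ck_on_sum[OF W] window_Ck_on_scaleR[OF W]
        window_Ck_on_bounded_linear[OF W bounded_linear_inner_left])
  with cont der show ?case by (intro window_Ck_on_SucI[OF W])
qed

text \<open>A function on an open set is a function of a window with one entry, so the calculus of \<open>Ck_on\<close> is an
instance of that of \<open>window_Ck_on\<close>.\<close>

lemma continuous_on_iff_window:
  "continuous_on S f \<longleftrightarrow> continuous_on {w :: unit \<Rightarrow> _. w () \<in> S} (\<lambda>w. f (w ()))"
proof -
  have "continuous_on S (\<lambda>x. (\<lambda>_::unit. x))"
    by (intro continuous_on_coordinatewise_then_product continuous_on_id)
  then show ?thesis
    using continuous_on_compose2[of "{w :: unit \<Rightarrow> _. w () \<in> S}" "\<lambda>w. f (w ())" S "\<lambda>x. (\<lambda>_. x)"]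
      continuous_on_compose2[of S f "{w :: unit \<Rightarrow> _. w () \<in> S}" "\<lambda>w. w ()"]
    by (auto intro: continuous_on_subset[OF continuous_on_product_coordinates])
qed

lemma Ck_on_iff_window:
  "Ck_on k S f \<longleftrightarrow> window_Ck_on k UNIV {w :: unit \<Rightarrow> _. w () \<in> S} (\<lambda>w. f (w ()))"
proof (induction k arbitrary: f)
  case 0
  show ?case
    unfolding Ck_on.simps(1) window_Ck_on.simps(1) by (rule continuous_on_iff_window)
next
  case (Suc k)
  have d: "(\<forall>w :: unit \<Rightarrow> _. w () \<in> S \<longrightarrow> f differentiable (at (w ()))) \<longleftrightarrow> (\<forall>x\<in>S. f differentiable (at x))"
  proof (intro iffI ballI)
    fix x assume "\<forall>w :: unit \<Rightarrow> _. w () \<in> S \<longrightarrow> f differentiable (at (w ()))" "x \<in> S"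
    then show "f differentiable (at x)" by (elim allE[of _ "\<lambda>_. x"]) simp
  qed auto
  show ?case
    unfolding Ck_on.simps(2) window_Ck_on.simps(2) UNIV_unit ball_simps Suc continuous_on_iff_window[of S f] fun_upd_same by (simp add: d)
qed

lemma window_open_unit:
  assumes "open S"
  shows "window_open UNIV {w :: unit \<Rightarrow> _. w () \<in> S}"
proof -
  have "{w :: unit \<Rightarrow> _. w () \<in> S} = {w. \<forall>i\<in>UNIV. w i \<in> S}"
    by (simp add: UNIV_unit)
  then show ?thesis
    using window_open_entries[OF assms, of "UNIV :: unit set"] by (simp only:)
qed

section \<open>Smooth functions on open sets\<close>

lemma Ck_on_subset:
  assumes "Ck_on k S f" "T \<subseteq> S"
  shows "Ck_on k T f"
  using assms(1) by (induction k arbitrary: f) (use assms(2) in \<open>auto intro: continuous_on_subset\<close>)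

lemma Ck_on_cong:
  assumes "open S" "\<And>x. x \<in> S \<Longrightarrow> f x = g x" "Ck_on k S f"
  shows "Ck_on k S g"
  unfolding Ck_on_iff_window
  by (rule window_Ck_on_cong[OF window_open_unit[OF assms(1)] _ assms(3)[unfolded Ck_on_iff_window]])
    (simp add: assms(2))

lemma Ck_on_SucI:
  assumes S: "open S" and der: "\<And>x. x \<in> S \<Longrightarrow> (f has_derivative D x) (at x)"
    and D: "\<And>v. Ck_on k S (\<lambda>x. D x v)"
  shows "Ck_on (Suc k) S f"
proof -
  have "Ck_on k S (\<lambda>x. frechet_derivative f (at x) v)" for v
    by (rule Ck_on_cong[OF S _ D[of v]]) (simp add: frechet_derivative_at[OF der])
  moreover have "continuous_on S f"
    by (rule has_derivative_continuous_on) (rule has_derivative_at_withinI[OF der])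
  ultimately show ?thesis
    using der by (auto intro: differentiableI)
qed

lemma Ck_on_bounded_linear: "open S \<Longrightarrow> bounded_linear L \<Longrightarrow> Ck_on k S f \<Longrightarrow> Ck_on k S (\<lambda>x. L (f x))"
  unfolding Ck_on_iff_window by (rule window_Ck_on_bounded_linear[OF window_open_unit])

lemma Ck_on_ident: "open S \<Longrightarrow> Ck_on k S (\<lambda>x. x)"
  unfolding Ck_on_iff_window by (rule window_Ck_on_entry[OF window_open_unit])

lemma Ck_on_diff: "open S \<Longrightarrow> Ck_on k S f \<Longrightarrow> Ck_on k S g \<Longrightarrow> Ck_on k S (\<lambda>x. f x - g x)"
  unfolding Ck_on_iff_window by (rule window_Ck_on_diff[OF window_open_unit])

lemma Ck_on_sum: "open S \<Longrightarrow> (\<And>a. a \<in> X \<Longrightarrow> Ck_on k S (f a)) \<Longrightarrow> Ck_on k S (\<lambda>x. \<Sum>a\<in>X. f a x)"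
  unfolding Ck_on_iff_window by (rule window_Ck_on_sum[OF window_open_unit])

lemma Ck_on_Pair: "open S \<Longrightarrow> Ck_on k S f \<Longrightarrow> Ck_on k S g \<Longrightarrow> Ck_on k S (\<lambda>x. (f x, g x))"
  unfolding Ck_on_iff_window by (rule window_Ck_on_Pair[OF window_open_unit])

lemma Ck_on_scaleR: "open S \<Longrightarrow> Ck_on k S f \<Longrightarrow> Ck_on k S g \<Longrightarrow> Ck_on k S (\<lambda>x. f x *\<^sub>R g x)"
  unfolding Ck_on_iff_window by (rule window_Ck_on_scaleR[OF window_open_unit])

lemma Ck_on_compose:
  fixes f :: "'a::euclidean_space \<Rightarrow> 'b::real_normed_vector"
  assumes "open S" "Ck_on k T f" "Ck_on k S g" "\<And>x. x \<in> S \<Longrightarrow> g x \<in> T"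
  shows "Ck_on k S (\<lambda>x. f (g x))"
  unfolding Ck_on_iff_window[of k S]
  by (rule window_Ck_on_compose[OF window_open_unit[OF assms(1)] assms(2)
        assms(3)[unfolded Ck_on_iff_window]]) (simp add: assms(4))

lemma smooth_on_derivative:
  assumes "smooth_on S f" "x \<in> S"
  shows "(f has_derivative frechet_derivative f (at x)) (at x)"
proof -
  have "Ck_on 1 S f" using assms(1) by (simp add: smooth_on_def)
  then show ?thesis using assms(2) by (auto simp: frechet_derivative_works)
qed

lemma smooth_on_frechet_derivative:
  assumes "smooth_on S f"
  shows "smooth_on S (\<lambda>x. frechet_derivative f (at x) v)"
  unfolding smooth_on_def
proof
  fix k
  have "Ck_on (Suc k) S f" using assms by (simp add: smooth_on_def)
  then show "Ck_on k S (\<lambda>x. frechet_derivative f (at x) v)" by simp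
qed

lemma smooth_on_continuous: "smooth_on S f \<Longrightarrow> continuous_on S f"
  unfolding smooth_on_def by (blast intro: Ck_on_continuous)

lemma smooth_on_subset: "smooth_on S f \<Longrightarrow> T \<subseteq> S \<Longrightarrow> smooth_on T f"
  unfolding smooth_on_def by (blast intro: Ck_on_subset[of _ S])

lemma smooth_on_cong:
  "open S \<Longrightarrow> (\<And>x. x \<in> S \<Longrightarrow> f x = g x) \<Longrightarrow> smooth_on S f \<Longrightarrow> smooth_on S g"
  unfolding smooth_on_def by (blast intro: Ck_on_cong)

lemma smooth_on_bounded_linear:
  "open S \<Longrightarrow> bounded_linear L \<Longrightarrow> smooth_on S f \<Longrightarrow> smooth_on S (\<lambda>x. L (f x))"
  unfolding smooth_on_def by (blast intro: Ck_on_bounded_linear)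

lemma smooth_on_ident: "open S \<Longrightarrow> smooth_on S (\<lambda>x. x)"
  unfolding smooth_on_def by (blast intro: Ck_on_ident)

lemma smooth_on_linear: "open S \<Longrightarrow> bounded_linear L \<Longrightarrow> smooth_on S L"
  using smooth_on_bounded_linear[OF _ _ smooth_on_ident] .

lemma smooth_on_Pair:
  "open S \<Longrightarrow> smooth_on S f \<Longrightarrow> smooth_on S g \<Longrightarrow> smooth_on S (\<lambda>x. (f x, g x))"
  unfolding smooth_on_def by (blast intro: Ck_on_Pair)

lemma smooth_on_diff:
  "open S \<Longrightarrow> smooth_on S f \<Longrightarrow> smooth_on S g \<Longrightarrow> smooth_on S (\<lambda>x. f x - g x)"
  unfolding smooth_on_def by (blast intro: Ck_on_diff)

lemma smooth_on_compose:
  fixes f :: "'a::euclidean_space \<Rightarrow> 'b::real_normed_vector"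
  assumes "open S" "smooth_on T f" "smooth_on S g" "\<And>x. x \<in> S \<Longrightarrow> g x \<in> T"
  shows "smooth_on S (\<lambda>x. f (g x))"
  using assms(2,3) unfolding smooth_on_def
  by (intro allI Ck_on_compose[where T = T and f = f and g = g] assms(1,4)) simp_all

section \<open>The smooth inverse function theorem\<close>

text \<open>Where the scalar factor vanishes, the product rule requires only continuity of the other factor. This is how the
derivative of an inverse matrix is obtained below from its continuity.\<close>

lemma has_derivative_scaleR_vanishing:
  fixes c :: "'a::real_normed_vector \<Rightarrow> 'b::real_normed_vector"
  assumes u: "(u has_derivative u') (at y)" and "u y = 0" and c: "isCont c y"
  shows "((\<lambda>z. u z *\<^sub>R c z) has_derivative (\<lambda>e. u' e *\<^sub>R c y)) (at y)"
proof -
  have "((\<lambda>z. u z *\<^sub>R (c z - c y)) has_derivative (\<lambda>e. 0)) (at y)"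
    unfolding has_derivative_at_within
  proof (intro conjI)
    obtain K where K: "\<And>e. norm (u' e) \<le> norm e * K"
      using has_derivative_bounded_linear[OF u] bounded_linear.bounded by blast
    have lim: "((\<lambda>z. norm (u z - u y - u' (z - y)) / norm (z - y)) \<longlongrightarrow> 0) (at y)"
    proof -
      have "((\<lambda>z. (u z - u y - u' (z - y)) /\<^sub>R norm (z - y)) \<longlongrightarrow> 0) (at y)"
        using u unfolding has_derivative_at_within by blast
      from tendsto_norm_zero[OF this] show ?thesis
        by (simp add: divide_inverse_commute abs_mult)
    qed
    have "((\<lambda>z. (norm (u z - u y - u' (z - y)) / norm (z - y) + K) * norm (c z - c y)) \<longlongrightarrow> (0 + K) * 0) (at y)"
      using lim c unfolding isCont_def by (intro tendsto_intros) (auto intro: tendsto_norm_zero LIM_zero)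
    then have lim2: "((\<lambda>z. (norm (u z - u y - u' (z - y)) / norm (z - y) + K) * norm (c z - c y)) \<longlongrightarrow> 0) (at y)"
      by simp
    have "((\<lambda>z. (u z *\<^sub>R (c z - c y)) /\<^sub>R norm (z - y)) \<longlongrightarrow> 0) (at y)"
    proof (rule Lim_null_comparison[OF _ lim2])
      show "\<forall>\<^sub>F z in at y. norm ((u z *\<^sub>R (c z - c y)) /\<^sub>R norm (z - y))
          \<le> (norm (u z - u y - u' (z - y)) / norm (z - y) + K) * norm (c z - c y)"
        unfolding eventually_at_filter
      proof (intro always_eventually allI impI)
        fix z assume "z \<noteq> y"
        have "norm (u z) \<le> norm (u z - u y - u' (z - y)) + norm (u' (z - y))"
          using norm_triangle_ineq[of "u z - u y - u' (z - y)" "u' (z - y)"] \<open>u y = 0\<close> by simp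
        also have "\<dots> \<le> norm (u z - u y - u' (z - y)) + norm (z - y) * K"
          using K by (intro add_left_mono)
        finally have "norm (u z) / norm (z - y) \<le> norm (u z - u y - u' (z - y)) / norm (z - y) + K"
          using \<open>z \<noteq> y\<close> by (simp add: field_simps)
        moreover have "norm ((u z *\<^sub>R (c z - c y)) /\<^sub>R norm (z - y)) = norm (u z) / norm (z - y) * norm (c z - c y)"
          by (simp add: divide_inverse abs_mult)
        ultimately
        show "norm ((u z *\<^sub>R (c z - c y)) /\<^sub>R norm (z - y))
            \<le> (norm (u z - u y - u' (z - y)) / norm (z - y) + K) * norm (c z - c y)"
          by (simp only: mult_right_mono norm_ge_zero)
      qed
    qed
    then show "((\<lambda>z. (u z *\<^sub>R (c z - c y) - u y *\<^sub>R (c y - c y) - 0) /\<^sub>R norm (z - y)) \<longlongrightarrow> 0) (at y)"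
      by simp
  qed simp
  moreover have "((\<lambda>z. u z *\<^sub>R c y) has_derivative (\<lambda>e. u' e *\<^sub>R c y)) (at y)"
    using u by (rule has_derivative_scaleR_left)
  ultimately have "((\<lambda>z. u z *\<^sub>R (c z - c y) + u z *\<^sub>R c y) has_derivative (\<lambda>e. 0 + u' e *\<^sub>R c y)) (at y)"
    by (rule has_derivative_add)
  then show ?thesis by (simp add: algebra_simps)
qed

text \<open>The inverse \<open>B z\<close> of an invertible linear map \<open>A z\<close> depends continuously on \<open>z\<close>: near \<open>y\<close> the maps
  \<open>A z\<close> are bounded below by a common constant, hence the maps \<open>B z\<close> are bounded above, and
  \<open>B z v - B y v = B z (A y b - A z b)\<close> for \<open>b = B y v\<close>.\<close>

lemma isCont_inverse_linear:
  fixes A :: "'c::real_normed_vector \<Rightarrow> 'a::euclidean_space \<Rightarrow> 'a"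
  assumes T: "open T" "y \<in> T"
    and A: "\<And>z. z \<in> T \<Longrightarrow> bounded_linear (A z)" and B: "\<And>z. z \<in> T \<Longrightarrow> bounded_linear (B z)"
    and AB: "\<And>z v. z \<in> T \<Longrightarrow> A z (B z v) = v" and BA: "\<And>z v. z \<in> T \<Longrightarrow> B z (A z v) = v"
    and cont: "\<And>v. isCont (\<lambda>z. A z v) y"
  shows "isCont (\<lambda>z. B z v) y"
proof -
  obtain K where K: "K > 0" "\<And>b. norm (B y b) \<le> norm b * K"
    using bounded_linear.pos_bounded[OF B[OF T(2)]] by blast
  define \<eta> where "\<eta> z = (\<Sum>e\<in>Basis. norm (A z e - A y e))" for z
  have Ad: "norm (A z b - A y b) \<le> norm b * \<eta> z" if "z \<in> T" for z b
  proof -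
    have "bounded_linear (\<lambda>b. A z b - A y b)"
      using A T that by (intro bounded_linear_sub) auto
    from bounded_linear_basis_expansion[OF this, of b]
    have "norm (A z b - A y b) = norm (\<Sum>e\<in>Basis. (b \<bullet> e) *\<^sub>R (A z e - A y e))" by simp
    also have "\<dots> \<le> (\<Sum>e\<in>Basis. norm ((b \<bullet> e) *\<^sub>R (A z e - A y e)))" by (rule norm_sum)
    also have "\<dots> \<le> (\<Sum>e\<in>Basis. norm b * norm (A z e - A y e))"
      by (intro sum_mono) (auto intro: mult_right_mono Basis_le_norm)
    finally show ?thesis by (simp add: \<eta>_def sum_distrib_left)
  qed
  have "(\<eta> \<longlongrightarrow> (\<Sum>e\<in>Basis. norm (A y e - A y e))) (at y)"
    unfolding \<eta>_def using cont[unfolded isCont_def] by (intro tendsto_intros)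
  then have "(\<eta> \<longlongrightarrow> 0) (at y)" by simp
  then have "\<forall>\<^sub>F z in at y. \<eta> z < 1 / (2 * K)"
    by (rule order_tendstoD) (use K in simp)
  moreover have "\<forall>\<^sub>F z in at y. z \<in> T"
    using T by (auto intro: eventually_at_in_open')
  ultimately have bound: "\<forall>\<^sub>F z in at y. norm (B z v - B y v) \<le> 2 * K * norm (A z (B y v) - A y (B y v))"
  proof eventually_elim
    case (elim z)
    define b where "b = B z v - B y v"
    have "A z b = A y (B y v) - A z (B y v)"
      using AB T elim bounded_linear.linear[OF A] by (simp add: b_def linear_diff)
    then have Azb: "norm (A z b) = norm (A z (B y v) - A y (B y v))"
      by (simp add: norm_minus_commute)
    have "norm b = norm (B y (A y b))" using BA T by simp
    also have "\<dots> \<le> norm (A y b) * K" by (rule K)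
    also have "\<dots> \<le> (norm (A z b) + norm (A z b - A y b)) * K"
      using K norm_triangle_ineq4[of "A z b" "A z b - A y b"] by (intro mult_right_mono) auto
    also have "\<dots> \<le> (norm (A z b) + norm b * (1 / (2 * K))) * K"
      using K Ad[OF elim(2), of b] elim(1) 
      by (intro mult_right_mono add_left_mono order_trans[OF Ad[OF elim(2)]] mult_left_mono) auto
    also have "\<dots> = K * norm (A z b) + norm b / 2"
      using K by (simp add: field_simps)
    finally show ?case unfolding Azb by (simp add: b_def)
  qed
  have "((\<lambda>z. 2 * K * norm (A z (B y v) - A y (B y v))) \<longlongrightarrow> 2 * K * norm (A y (B y v) - A y (B y v))) (at y)"
    using cont[unfolded isCont_def] by (intro tendsto_intros)
  then have "((\<lambda>z. B z v - B y v) \<longlongrightarrow> 0) (at y)"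
    by (intro Lim_null_comparison[OF bound]) simp
  then show ?thesis unfolding isCont_def by (simp add: LIM_zero_iff)
qed

text \<open>Bootstrapping: with \<open>A y = Df (q y)\<close> and \<open>B y\<close> its inverse, \<open>Dq (y) v = B y v\<close> and
\<open>D (B v) (y) e = - B y (D\<^sup>2f (q y) (B y v) (B y e))\<close>. The right hand sides are built from \<open>q\<close>, \<open>B\<close> and derivatives
of \<open>f\<close>, so if \<open>q\<close> and all \<open>B v\<close> are k times continuously differentiable, they are so \<open>k + 1\<close> times.\<close>

lemma smooth_on_inverse:
  fixes f :: "'a::euclidean_space \<Rightarrow> 'a"
  assumes S: "open S" and T: "open T" and f: "smooth_on S f" and qS: "\<And>y. y \<in> T \<Longrightarrow> q y \<in> S"
    and qB: "\<And>y. y \<in> T \<Longrightarrow> (q has_derivative B y) (at y)"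
    and AB: "\<And>y v. y \<in> T \<Longrightarrow> frechet_derivative f (at (q y)) (B y v) = v"
  shows "smooth_on T q"
proof -
  define A where "A y = frechet_derivative f (at (q y))" for y
  note AB = AB[folded A_def]
  have A: "bounded_linear (A y)" if "y \<in> T" for y
    unfolding A_def by (rule has_derivative_bounded_linear[OF smooth_on_derivative[OF f qS[OF that]]])
  have B: "bounded_linear (B y)" if "y \<in> T" for y
    by (rule has_derivative_bounded_linear[OF qB[OF that]])
  have BA: "B y (A y v) = v" if "y \<in> T" for y v
  proof -
    have "A y \<circ> B y = id" using AB[OF that] by auto
    then have "B y \<circ> A y = id"
      using linear_inverse_left[OF bounded_linear.linear[OF A[OF that]] bounded_linear.linear[OF B[OF that]]] by simp
    then show ?thesis by (simp add: fun_eq_iff)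
  qed
  have qc: "isCont q y" if "y \<in> T" for y
    by (rule has_derivative_continuous[OF qB[OF that]])
  define \<psi> where "\<psi> b x = frechet_derivative f (at x) b" for b x
  have \<psi>: "smooth_on S (\<psi> b)" for b
    unfolding \<psi>_def by (rule smooth_on_frechet_derivative[OF f])
  have \<psi>A: "\<psi> b (q y) = A y b" for b y by (simp add: \<psi>_def A_def)
  have Bc: "isCont (\<lambda>y. B y v) y" if "y \<in> T" for y v
  proof (rule isCont_inverse_linear[OF T that A B AB BA])
    show "isCont (\<lambda>y. A y v) y" for v
      unfolding \<psi>A[symmetric]
      by (rule isCont_o2[OF qc[OF that] has_derivative_continuous[OF smooth_on_derivative[OF \<psi> qS[OF that]]]])
  qed
  define D2 where "D2 x b e = frechet_derivative (\<psi> b) (at x) e" for x b e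
  have \<psi>q: "((\<lambda>z. \<psi> b (q z)) has_derivative (\<lambda>e. D2 (q y) b (B y e))) (at y)" if "y \<in> T" for b y
    using has_derivative_compose[OF qB[OF that] smooth_on_derivative[OF \<psi> qS[OF that]]]
    unfolding D2_def .
  have Bd: "((\<lambda>z. B z v) has_derivative (\<lambda>e. - B y (D2 (q y) (B y v) (B y e)))) (at y)" if y: "y \<in> T" for y v
  proof -
    define b where "b = B y v"
    \<comment> \<open>\<open>B z v - b = B z (A y b - A z b)\<close>, expanded in a basis: each coefficient vanishes at \<open>y\<close>\<close>
    define u where "u a z = (\<psi> b (q y) - \<psi> b (q z)) \<bullet> a" for a z
    have "(u a has_derivative (\<lambda>e. (0 - D2 (q y) b (B y e)) \<bullet> a)) (at y)" for a
      unfolding u_def by (intro has_derivative_inner_left has_derivative_diff has_derivative_const \<psi>q y)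
    from has_derivative_scaleR_vanishing[OF this _ Bc[OF y]]
    have "((\<lambda>z. u a z *\<^sub>R B z a) has_derivative (\<lambda>e. ((0 - D2 (q y) b (B y e)) \<bullet> a) *\<^sub>R B y a)) (at y)" for a
      by (simp add: u_def)
    then have "((\<lambda>z. b + (\<Sum>a\<in>Basis. u a z *\<^sub>R B z a)) has_derivative
        (\<lambda>e. 0 + (\<Sum>a\<in>Basis. ((0 - D2 (q y) b (B y e)) \<bullet> a) *\<^sub>R B y a))) (at y)"
      by (intro has_derivative_add has_derivative_const has_derivative_sum)
    moreover have "0 + (\<Sum>a\<in>Basis. ((0 - D2 (q y) b (B y e)) \<bullet> a) *\<^sub>R B y a) = - B y (D2 (q y) (B y v) (B y e))" for e
      unfolding bounded_linear_basis_expansion[OF B[OF y], symmetric]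
      using bounded_linear.linear[OF B[OF y]] by (simp add: b_def linear_neg)
    ultimately have "((\<lambda>z. b + (\<Sum>a\<in>Basis. u a z *\<^sub>R B z a)) has_derivative
        (\<lambda>e. - B y (D2 (q y) (B y v) (B y e)))) (at y)" by simp
    moreover have "b + (\<Sum>a\<in>Basis. u a z *\<^sub>R B z a) = B z v" if z: "z \<in> T" for z
    proof -
      have "(\<Sum>a\<in>Basis. u a z *\<^sub>R B z a) = B z (A y b - A z b)"
        unfolding u_def \<psi>A by (rule bounded_linear_basis_expansion[OF B[OF z], symmetric])
      also have "\<dots> = B z v - b"
        using AB[OF y] BA[OF z] bounded_linear.linear[OF B[OF z]] by (simp add: b_def linear_diff)
      finally show ?thesis by simp
    qed
    ultimately show ?thesis
      by (rule has_derivative_transform_within_open[OF _ T y]) 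
  qed
  have "Ck_on k T q \<and> (\<forall>v. Ck_on k T (\<lambda>y. B y v))" for k
  proof (induction k)
    case 0
    then show ?case using qc Bc by (auto intro: continuous_at_imp_continuous_on)
  next
    case (Suc k)
    then have qk: "Ck_on k T q" and Bk: "\<And>v. Ck_on k T (\<lambda>y. B y v)" by auto
    have "Ck_on (Suc k) T q"
      by (rule Ck_on_SucI[OF T qB Bk])
    moreover have "Ck_on (Suc k) T (\<lambda>y. B y v)" for v
    proof (rule Ck_on_SucI[OF T Bd])
      fix e
      have D2k: "Ck_on k T (\<lambda>y. D2 (q y) a c)" for a c
      proof (rule Ck_on_compose[OF T _ qk qS])
        show "Ck_on k S (\<lambda>x. D2 x a c)"
          using smooth_on_frechet_derivative[OF \<psi>, of a c] unfolding D2_def smooth_on_def by blast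
      qed
      \<comment> \<open>\<open>R\<close> is the second derivative term, written such that its regularity is visible\<close>
      define R where "R y = (\<Sum>a\<in>Basis. (B y v \<bullet> a) *\<^sub>R (\<Sum>c\<in>Basis. (B y e \<bullet> c) *\<^sub>R D2 (q y) a c))" for y
      have R: "R y = D2 (q y) (B y v) (B y e)" if y: "y \<in> T" for y
      proof -
        have 1: "(\<Sum>c\<in>Basis. (B y e \<bullet> c) *\<^sub>R D2 (q y) a c) = D2 (q y) a (B y e)" for a
          unfolding D2_def
          by (rule bounded_linear_basis_expansion[OF has_derivative_bounded_linear[OF smooth_on_derivative[OF \<psi> qS[OF y]]], symmetric])
        have "(\<lambda>x. \<Sum>a\<in>Basis. (B y v \<bullet> a) *\<^sub>R \<psi> a x) x = \<psi> (B y v) x" if "x \<in> S" for x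
          unfolding \<psi>_def
          by (simp add: bounded_linear_basis_expansion[OF has_derivative_bounded_linear[OF smooth_on_derivative[OF f that]], symmetric])
        moreover have "((\<lambda>x. \<Sum>a\<in>Basis. (B y v \<bullet> a) *\<^sub>R \<psi> a x) has_derivative
            (\<lambda>e. \<Sum>a\<in>Basis. (B y v \<bullet> a) *\<^sub>R D2 (q y) a e)) (at (q y))"
          unfolding D2_def
          by (intro has_derivative_sum has_derivative_scaleR_right smooth_on_derivative[OF \<psi> qS[OF y]])
        ultimately have "(\<psi> (B y v) has_derivative (\<lambda>e. \<Sum>a\<in>Basis. (B y v \<bullet> a) *\<^sub>R D2 (q y) a e)) (at (q y))"
          by (rule has_derivative_transform_within_open[OF _ S qS[OF y], rotated])
        then have "D2 (q y) (B y v) = (\<lambda>e. \<Sum>a\<in>Basis. (B y v \<bullet> a) *\<^sub>R D2 (q y) a e)"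
          unfolding D2_def by (rule frechet_derivative_at[symmetric])
        then show ?thesis unfolding R_def 1 by simp
      qed
      have Rk: "Ck_on k T R"
        unfolding R_def
        by (intro Ck_on_sum Ck_on_scaleR Ck_on_bounded_linear[OF T bounded_linear_inner_left] T Bk D2k)
      have "Ck_on k T (\<lambda>y. - (\<Sum>a\<in>Basis. (R y \<bullet> a) *\<^sub>R B y a))"
        by (intro Ck_on_bounded_linear[OF T bounded_linear_minus[OF bounded_linear_ident]]
            Ck_on_sum Ck_on_scaleR Ck_on_bounded_linear[OF T bounded_linear_inner_left] T Bk Rk)
      then show "Ck_on k T (\<lambda>y. - B y (D2 (q y) (B y v) (B y e)))"
        by (rule Ck_on_cong[OF T, rotated])
          (simp add: R bounded_linear_basis_expansion[OF B, symmetric])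
    qed
    ultimately show ?case by blast
  qed
  then show ?thesis by (simp add: smooth_on_def)
qed

theorem smooth_inverse_function:
  fixes f :: "'a::euclidean_space \<Rightarrow> 'a"
  assumes U: "open U" "x0 \<in> U" and f: "smooth_on U f" and inj: "inj (frechet_derivative f (at x0))"
  obtains S T q where "open S" "x0 \<in> S" "S \<subseteq> U" "open T" "f x0 \<in> T" "homeomorphism S T f q" "smooth_on T q"
    "\<And>y. y \<in> T \<Longrightarrow> inj (frechet_derivative f (at (q y)))"
proof -
  define f' where "f' x = Blinfun (frechet_derivative f (at x))" for x
  have f': "blinfun_apply (f' x) = frechet_derivative f (at x)" if "x \<in> U" for x
    unfolding f'_def
    by (rule bounded_linear_Blinfun_apply[OF has_derivative_bounded_linear[OF smooth_on_derivative[OF f that]]])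
  have der: "(f has_derivative blinfun_apply (f' x)) (at x)" if "x \<in> U" for x
    using smooth_on_derivative[OF f that] f'[OF that] by simp
  have cont: "continuous_on U f'"
  proof (rule continuous_on_blinfun_componentwise)
    fix i :: 'a
    have "continuous_on U (\<lambda>x. frechet_derivative f (at x) i)"
      by (rule smooth_on_continuous[OF smooth_on_frechet_derivative[OF f]])
    then show "continuous_on U (\<lambda>x. blinfun_apply (f' x) i)"
      using f' by (simp cong: continuous_on_cong)
  qed
  have lin: "linear (frechet_derivative f (at x0))"
    by (rule bounded_linear.linear[OF has_derivative_bounded_linear[OF smooth_on_derivative[OF f U(2)]]])
  obtain g where g: "linear g" "g \<circ> frechet_derivative f (at x0) = id"
    using linear_injective_left_inverse[OF lin inj] by blast
  have "Blinfun g o\<^sub>L f' x0 = id_blinfun"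
    by (rule blinfun_eqI) (use g f'[OF U(2)] in \<open>simp add: bounded_linear_Blinfun_apply linear_conv_bounded_linear fun_eq_iff\<close>)
  from inverse_function_theorem[OF U(1) der cont U(2) this]
  obtain S T q q' where *: "open S" "S \<subseteq> U" "x0 \<in> S" "open T" "f x0 \<in> T" "homeomorphism S T f q"
    "\<And>y. y \<in> T \<Longrightarrow> (q has_derivative (q' y)) (at y)"
    "\<And>y. y \<in> T \<Longrightarrow> q' y = inv (blinfun_apply (f'(q y)))"
    "\<And>y. y \<in> T \<Longrightarrow> bij (blinfun_apply (f'(q y)))"
    by metis
  have qS: "q y \<in> S" if "y \<in> T" for y
    using *(6) that by (auto simp: homeomorphism_def)
  have bij: "bij (frechet_derivative f (at (q y)))" if "y \<in> T" for y
    using *(9)[OF that] f' qS[OF that] *(2) by auto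
  have "smooth_on T q"
  proof (rule smooth_on_inverse[OF *(1,4) smooth_on_subset[OF f *(2)] qS *(7)])
    fix y v assume "y \<in> T"
    then show "frechet_derivative f (at (q y)) (q' y v) = v"
      using *(2,8) bij f' qS surj_f_inv_f[OF bij_is_surj[OF bij]] by (metis subsetD)
  qed
  then show thesis
    using that[of S T q] * bij bij_is_inj by blast
qed

section \<open>The triangular structure of the derivative\<close>

text \<open>The rows of the masked matrix span a space of dimension \<open>card C\<close> inside the vectors supported in \<open>C\<close>, hence
all of them. A vector supported in \<open>C\<close> that is annihilated by the matrix is orthogonal to that span, hence to
itself.\<close>

lemma sub_rank_kernel:
  fixes A :: "real^'j^'i"
  assumes rank: "sub_rank R C A = card C"
    and c: "\<And>j. j \<notin> C \<Longrightarrow> c $ j = 0" and Ac: "\<And>i. i \<in> R \<Longrightarrow> (A *v c) $ i = 0"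
  shows "c = 0"
proof -
  define B where "B = (\<chi> i j. if i \<in> R \<and> j \<in> C then A $ i $ j else 0)"
  define V where "V = {x::real^'j. \<forall>j. j \<notin> C \<longrightarrow> x $ j = 0}"
  have "rows B \<subseteq> V"
    by (auto simp: rows_def row_def B_def V_def)
  moreover have "dim V \<le> dim (rows B)"
    using rank dim_substandard_cart[of C, where 'a = real]
    by (simp add: sub_rank_def B_def[symmetric] row_rank_def V_def[symmetric] dim_vec_eq[symmetric])
  ultimately have "span (rows B) = span V"
    by (rule dim_eq_span)
  moreover have "c \<in> V" using c by (simp add: V_def)
  ultimately have cs: "c \<in> span (rows B)" by (simp add: span_base)
  have "B *v c = 0"
  proof (rule vec_eq_iff[THEN iffD2, rule_format])
    fix i
    show "(B *v c) $ i = 0 $ i"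
    proof (cases "i \<in> R")
      case True
      have "(B *v c) $ i = (A *v c) $ i"
        unfolding matrix_vector_mult_def B_def using True c by (auto intro!: sum.cong)
      then show ?thesis using Ac[OF True] by simp
    qed (simp add: B_def matrix_vector_mult_def)
  qed
  then have "row i B \<bullet> c = 0" for i
    using matrix_vector_mul_component[of B c i] by (simp add: row_def vec_lambda_eta)
  then have "orthogonal c r" if "r \<in> rows B" for r
    using that by (auto simp: rows_def orthogonal_def inner_commute)
  from orthogonal_to_span[OF cs this] show ?thesis
    by (simp add: orthogonal_self)
qed

lemma jac_mult:
  fixes g :: "(real^'n) \<times> (real^'m) \<Rightarrow> real^'l"
  assumes "bounded_linear (frechet_derivative g (at z))"
  shows "jac g z *v (\<chi> j. case j of Inl a \<Rightarrow> x $ a | Inr b \<Rightarrow> u $ b) = frechet_derivative g (at z) (x, u)"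
proof -
  interpret bounded_linear "frechet_derivative g (at z)" by fact
  let ?D = "frechet_derivative g (at z)"
  have "(x, u) = (\<Sum>a\<in>UNIV. (x $ a) *\<^sub>R (axis a 1, 0)) + (\<Sum>b\<in>UNIV. (u $ b) *\<^sub>R (0, axis b 1))"
    using basis_expansion[of x] basis_expansion[of u] unfolding scalar_mult_eq_scaleR
    by (intro prod_eqI) (simp_all only: fst_add snd_add fst_sum snd_sum fst_scaleR snd_scaleR
        fst_conv snd_conv scaleR_zero_right sum.neutral_const add_0_left add_0_right)
  then have "?D (x, u) = ?D ((\<Sum>a\<in>UNIV. (x $ a) *\<^sub>R (axis a 1, 0)) + (\<Sum>b\<in>UNIV. (u $ b) *\<^sub>R (0, axis b 1)))"
    by (rule arg_cong)
  also have "\<dots> = (\<Sum>a\<in>UNIV. (x $ a) *\<^sub>R ?D (axis a 1, 0)) + (\<Sum>b\<in>UNIV. (u $ b) *\<^sub>R ?D (0, axis b 1))"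
    by (simp only: add sum scaleR)
  finally have D: "?D (x, u) = (\<Sum>a\<in>UNIV. (x $ a) *\<^sub>R ?D (axis a 1, 0)) + (\<Sum>b\<in>UNIV. (u $ b) *\<^sub>R ?D (0, axis b 1))" .
  have split: "(\<Sum>j\<in>UNIV. h j) = (\<Sum>a\<in>UNIV. h (Inl a)) + (\<Sum>b\<in>UNIV. h (Inr b))" for h :: "'n + 'm \<Rightarrow> real"
    using sum.Plus[of "UNIV :: 'n set" "UNIV :: 'm set" h] by (simp add: comp_def)
  show ?thesis
    unfolding D by (simp add: vec_eq_iff matrix_vector_mult_def jac_def split mult.commute)
qed

lemma derivative_independent_direction:
  fixes g :: "'a::real_normed_vector \<Rightarrow> real^'l"
  assumes U: "open U" "z \<in> U" and D: "(g has_derivative D) (at z)"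
    and const: "\<And>t. z + t *\<^sub>R d \<in> U \<Longrightarrow> g (z + t *\<^sub>R d) $ i = g z $ i"
  shows "D d $ i = 0"
proof -
  have "((\<lambda>t. z + t *\<^sub>R d) has_derivative (\<lambda>t. t *\<^sub>R d)) (at (0::real))"
    by (auto intro!: derivative_eq_intros)
  from has_derivative_compose[OF this, of g D]
  have "((\<lambda>t. g (z + t *\<^sub>R d)) has_derivative (\<lambda>t. D (t *\<^sub>R d))) (at (0::real))"
    using D by simp
  then have 1: "((\<lambda>t. g (z + t *\<^sub>R d) $ i) has_derivative (\<lambda>t. D (t *\<^sub>R d) $ i)) (at (0::real))"
    by (rule bounded_linear.has_derivative[OF bounded_linear_vec_nth])
  have "open ((\<lambda>t::real. z + t *\<^sub>R d) -` U)"
    by (intro open_vimage U continuous_intros)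
  from has_derivative_transform_within_open[OF 1 this]
  have "((\<lambda>t. g z $ i) has_derivative (\<lambda>t. D (t *\<^sub>R d) $ i)) (at (0::real))"
    using U const by simp
  from has_derivative_unique[OF this has_derivative_const]
  have "D (1 *\<^sub>R d) $ i = 0" by metis
  then show ?thesis by simp
qed

text \<open>Descending induction over the labels. If the components of \<open>(dx, du)\<close> with label \<open>> l\<close> vanish, then in the
rows with label \<open>l + 1\<close> only the columns with label \<open>l\<close> contribute, since these rows do not depend on smaller
labels. The columns outside \<open>H\<close> contribute nothing because \<open>dx\<close> vanishes there, and the remaining ones
form the square matrix of the rank condition.\<close>

lemma triangular_kernel:
  fixes g :: "(real^'n) \<times> (real^'m) \<Rightarrow> real^'n" and bx :: "'n \<Rightarrow> nat" and bu :: "'m \<Rightarrow> nat"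
  assumes labels: "\<And>j. bu j < p" "\<And>i. i \<in> H \<Longrightarrow> bx i < p"
    and U: "open U" "z \<in> U" and D: "(g has_derivative D) (at z)"
    and dep: "\<And>i x u x' u'. (x, u) \<in> U \<Longrightarrow> (x', u') \<in> U \<Longrightarrow>
        (\<And>j. bx i \<le> bx j + 1 \<Longrightarrow> x $ j = x' $ j) \<Longrightarrow> (\<And>j. bx i \<le> bu j + 1 \<Longrightarrow> u $ j = u' $ j) \<Longrightarrow>
        g (x, u) $ i = g (x', u') $ i"
    and rank: "\<And>l. l < p \<Longrightarrow> sub_rank {i. bx i = l + 1} (Inl ` {i\<in>H. bx i = l} \<union> Inr ` {j. bu j = l}) (jac g z)
        = card ((Inl ` {i\<in>H. bx i = l} \<union> Inr ` {j. bu j = l}) :: ('n + 'm) set)"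
    and dH: "\<And>i. i \<notin> H \<Longrightarrow> dx $ i = 0" and rows: "\<And>i. k < bx i \<Longrightarrow> D (dx, du) $ i = 0"
  shows "(\<forall>i. k \<le> bx i \<longrightarrow> dx $ i = 0) \<and> (\<forall>j. k \<le> bu j \<longrightarrow> du $ j = 0)"
proof -
  have top: "(\<forall>i. l \<le> bx i \<longrightarrow> dx $ i = 0) \<and> (\<forall>j. l \<le> bu j \<longrightarrow> du $ j = 0)" if "p \<le> l" for l
  proof (intro conjI allI impI)
    fix i assume "l \<le> bx i"
    then have "i \<notin> H" using labels(2)[of i] that by auto
    then show "dx $ i = 0" by (rule dH)
  next
    fix j assume "l \<le> bu j"
    then show "du $ j = 0" using labels(1)[of j] that by simp
  qed
  show ?thesis
  proof (cases "k \<le> p")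
    case False
    then show ?thesis using top[of k] by auto
  next
    case True
    then show ?thesis
    proof (induction rule: inc_induct)
      case base
      show ?case using top by simp
    next
      case (step l)
      \<comment> \<open>\<open>(cx, cu)\<close> is the part of \<open>(dx, du)\<close> in the columns of the rank condition for block \<open>l\<close>\<close>
      define cx where "cx = (\<chi> i. if i \<in> H \<and> bx i = l then dx $ i else 0)"
      define cu where "cu = (\<chi> j. if bu j = l then du $ j else 0)"
      define c :: "real^('n + 'm)" where "c = (\<chi> j. case j of Inl a \<Rightarrow> cx $ a | Inr b \<Rightarrow> cu $ b)"
      let ?C = "Inl ` {i\<in>H. bx i = l} \<union> Inr ` {j. bu j = l} :: ('n + 'm) set"
      have lin: "linear D" using D by (rule has_derivative_linear)
      have "c = 0"
      proof (rule sub_rank_kernel[OF rank[OF step(2)]])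
        show "c $ j = 0" if "j \<notin> ?C" for j
          using that by (cases j) (auto simp: c_def cx_def cu_def)
      next
        fix i assume "i \<in> {i. bx i = l + 1}"
        then have i: "bx i = l + 1" by simp
        have "D (dx - cx, du - cu) $ i = 0"
        proof (rule derivative_independent_direction[OF U D])
          fix t :: real assume t: "z + t *\<^sub>R (dx - cx, du - cu) \<in> U"
          have "(dx - cx) $ j = 0" if "bx i \<le> bx j + 1" for j
            using that i step(3) dH by (cases "bx j = l") (auto simp: cx_def)
          moreover have "(du - cu) $ j = 0" if "bx i \<le> bu j + 1" for j
            using that i step(3) by (cases "bu j = l") (auto simp: cu_def)
          moreover have "z + t *\<^sub>R (dx - cx, du - cu) = (fst z + t *\<^sub>R (dx - cx), snd z + t *\<^sub>R (du - cu))"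
            by (simp add: prod_eq_iff)
          ultimately show "g (z + t *\<^sub>R (dx - cx, du - cu)) $ i = g z $ i"
            using dep[of "fst z + t *\<^sub>R (dx - cx)" "snd z + t *\<^sub>R (du - cu)" "fst z" "snd z" i] t U(2)
            by simp
        qed
        moreover have "D (dx, du) $ i = 0" using rows i step(1) by simp
        moreover have "D (dx, du) = D (dx - cx, du - cu) + D (cx, cu)"
          using linear_add[OF lin, of "(dx - cx, du - cu)" "(cx, cu)"] by simp
        ultimately have "D (cx, cu) $ i = 0" by simp
        moreover have "frechet_derivative g (at z) = D"
          using frechet_derivative_at[OF D] by simp
        ultimately show "(jac g z *v c) $ i = 0"
          unfolding c_def using jac_mult[of g z cx cu] D
          by (simp add: has_derivative_bounded_linear)
      qed
      then have "c $ Inl a = 0" "c $ Inr b = 0" for a b by simp_all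
      then have cx0: "cx $ a = 0" and cu0: "cu $ b = 0" for a b by (simp_all add: c_def)
      show ?case
      proof (intro conjI allI impI)
        fix i assume "l \<le> bx i"
        then show "dx $ i = 0"
          using step(3) cx0[of i] dH[of i] by (cases "bx i = l") (auto simp: cx_def split: if_splits)
      next
        fix j assume "l \<le> bu j"
        then show "du $ j = 0"
          using step(3) cu0[of j] by (cases "bu j = l") (auto simp: cu_def split: if_splits)
      qed
    qed
  qed
qed

text \<open>Summing the dimension conditions over all blocks counts each row once, each state component in \<open>H\<close> once and
each input component once, so \<open>card H + m = n\<close>.\<close>

lemma card_flat_output:
  fixes bx :: "'n::finite \<Rightarrow> nat" and bu :: "'m::finite \<Rightarrow> nat"
  assumes labels: "\<And>i. 1 \<le> bx i" "\<And>i. bx i \<le> p" "\<And>j. bu j < p" "\<And>i. i \<in> H \<Longrightarrow> bx i < p"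
    and square: "\<And>l. l < p \<Longrightarrow> card ((Inl ` {i\<in>H. bx i = l} \<union> Inr ` {j. bu j = l}) :: ('n + 'm) set)
        = card {i. bx i = l + 1}"
  shows "card (- H) = CARD('m)"
proof -
  have fib: "(\<Sum>l<p. card {i \<in> X. h i = l}) = card X" if "\<And>i. i \<in> X \<Longrightarrow> h i < p"
    for X :: "'b::finite set" and h
    using sum.group[of X "{..<p}" h "\<lambda>_. 1::nat"] that by (auto simp: image_subset_iff)
  have "bx i - 1 = l \<longleftrightarrow> bx i = l + 1" for i l
    using labels(1)[of i] by auto
  then have "(\<Sum>l<p. card {i. bx i = l + 1}) = CARD('n)"
    using fib[of "UNIV :: 'n set" "\<lambda>i. bx i - 1"] labels(1,2)
    by (simp add: less_eq_Suc_le[symmetric] Suc_le_eq) (metis One_nat_def Suc_le_eq Suc_pred le_trans not_less_eq)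
  moreover have "(\<Sum>l<p. card {i. bx i = l + 1}) = (\<Sum>l<p. card {i\<in>H. bx i = l} + card {j. bu j = l})"
  proof (rule sum.cong[OF refl])
    fix l assume "l \<in> {..<p}"
    moreover have "card ((Inl ` {i\<in>H. bx i = l} \<union> Inr ` {j. bu j = l}) :: ('n + 'm) set)
        = card {i\<in>H. bx i = l} + card {j. bu j = l}"
      by (subst card_Un_disjoint) (auto simp: card_image)
    ultimately show "card {i. bx i = l + 1} = card {i\<in>H. bx i = l} + card {j. bu j = l}"
      using square[of l] by simp
  qed
  moreover have "(\<Sum>l<p. card {j. bu j = l}) = CARD('m)"
    using fib[of "UNIV :: 'm set" bu] labels(3) by simp
  moreover have "(\<Sum>l<p. card {i\<in>H. bx i = l}) = card H"
    using fib[of H bx] labels(4) by simp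
  ultimately have "card H + CARD('m) = CARD('n)"
    by (simp add: sum.distrib)
  then show ?thesis by (simp add: Compl_eq_Diff_UNIV card_Diff_subset)
qed

lemma local_diffeo_at_kernel:
  assumes "local_diffeo_at x \<Phi>" and D: "(\<Phi> has_derivative D) (at x)" and "D v = 0"
  shows "v = 0"
proof -
  obtain S T \<Psi> where S: "open S" "open T" "x \<in> S" "homeomorphism S T \<Phi> \<Psi>" and \<Psi>: "smooth_on T \<Psi>"
    using assms(1) unfolding local_diffeo_at_def by blast
  have "\<Phi> x \<in> T" using S by (auto simp: homeomorphism_def)
  from has_derivative_compose[OF D smooth_on_derivative[OF \<Psi> this]]
  have "((\<lambda>x. \<Psi> (\<Phi> x)) has_derivative (\<lambda>v. frechet_derivative \<Psi> (at (\<Phi> x)) (D v))) (at x)" .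
  then have "((\<lambda>x. x) has_derivative (\<lambda>v. frechet_derivative \<Psi> (at (\<Phi> x)) (D v))) (at x)"
    by (rule has_derivative_transform_within_open[OF _ S(1,3)]) (use S(4) in \<open>auto simp: homeomorphism_def\<close>)
  from has_derivative_unique[OF this has_derivative_ident]
  have "frechet_derivative \<Psi> (at (\<Phi> x)) (D v) = v" by metis
  then show ?thesis
    using \<open>D v = 0\<close> has_derivative_linear[OF smooth_on_derivative[OF \<Psi> \<open>\<Phi> x \<in> T\<close>]] by (simp add: linear_0)
qed

section \<open>The transformed system with the original input\<close>

text \<open>The infinitesimal form of solving the triangular system from the top: at \<open>(dx, du)\<close> with vanishing flat
output, rows of label \<open>> k\<close> that vanish force all state components of label \<open>\<ge> k\<close> to vanish. In contrast to the
triangular form itself, this property survives the replacement of the transformed input by the original one, which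
mixes the input components. The clause for \<open>k = 0\<close> includes the input, as then all rows vanish.\<close>

definition block_solvable ::
  "'n set \<Rightarrow> ('n \<Rightarrow> nat) \<Rightarrow> ((real^'n) \<times> (real^'m) \<Rightarrow> real^'n) \<Rightarrow> bool" where
  "block_solvable H bx D \<longleftrightarrow>
     (\<forall>k dx du. (\<forall>i. i \<notin> H \<longrightarrow> dx $ i = 0) \<longrightarrow> (\<forall>i. k < bx i \<longrightarrow> D (dx, du) $ i = 0) \<longrightarrow>
        (\<forall>i. k \<le> bx i \<longrightarrow> dx $ i = 0) \<and> (k = 0 \<longrightarrow> du = 0))"

text \<open>On a neighbourhood of the equilibrium, \<open>fbar = g \<circ> \<Theta>\<close> with \<open>\<Theta> (x, u) = (x, \<Phi>u (\<Psi> x, u))\<close> for the inverse \<open>\<Psi>\<close> of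
\<open>\<Phi>x\<close>. So the derivative of \<open>fbar\<close> at \<open>(dx, du)\<close> is that of \<open>g\<close> at \<open>dx\<close> and the resulting variation of the
transformed input; if both vanish, invertibility of \<open>\<Phi>u\<close> in the input gives \<open>du = 0\<close>.\<close>

lemma kept_input_system:
  fixes f g fbar :: "(real^'n) \<times> (real^'m) \<Rightarrow> real^'n"
    and \<Phi>x :: "real^'n \<Rightarrow> real^'n"
    and \<Phi>u :: "(real^'n) \<times> (real^'m) \<Rightarrow> real^'m"
  assumes f0: "f (xs, us) = 0"
    and tr: "state_input_transformation \<Phi>x \<Phi>u (xs, us)"
    and g: "transformed_system \<Phi>x \<Phi>u f (xs, us) g"
    and gs: "smooth_near (\<Phi>x xs, \<Phi>u (xs, us)) g"
    and blocks: "flat_triangular_blocks p bx bu H g (\<Phi>x xs, \<Phi>u (xs, us))"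
    and fbar: "transformed_system \<Phi>x snd f (xs, us) fbar"
  obtains U where "open U" "(\<Phi>x xs, us) \<in> U" "smooth_on U fbar" "fbar (\<Phi>x xs, us) = 0"
    "\<forall>z\<in>U. block_solvable H bx (frechet_derivative fbar (at z))"
proof -
  obtain S T \<Psi> where S: "open S" "open T" "xs \<in> S" "homeomorphism S T \<Phi>x \<Psi>"
    and \<Phi>xs: "smooth_on S \<Phi>x" and \<Psi>s: "smooth_on T \<Psi>"
    using tr unfolding state_input_transformation_def local_diffeo_at_def by auto
  obtain Uu where Uu: "open Uu" "(xs, us) \<in> Uu" and \<Phi>us: "smooth_on Uu \<Phi>u"
    using tr unfolding state_input_transformation_def smooth_near_def by auto
  obtain Ug where Ug: "open Ug" "(\<Phi>x xs, \<Phi>u (xs, us)) \<in> Ug" and gs: "smooth_on Ug g"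
    using gs unfolding smooth_near_def by auto
  have labels: "\<And>j. bu j < p" "\<And>i. i \<in> H \<Longrightarrow> bx i < p"
    using blocks unfolding flat_triangular_blocks_def by blast+
  obtain Ut where Ut: "open Ut" "(\<Phi>x xs, \<Phi>u (xs, us)) \<in> Ut"
    and dep: "\<forall>i. \<forall>(x, u)\<in>Ut. \<forall>(x', u')\<in>Ut. (\<forall>j. bx i \<le> bx j + 1 \<longrightarrow> x $ j = x' $ j) \<longrightarrow>
        (\<forall>j. bx i \<le> bu j + 1 \<longrightarrow> u $ j = u' $ j) \<longrightarrow> g (x, u) $ i = g (x', u') $ i"
    and rank: "\<forall>k<p. let R = {i. bx i = k + 1}; C = Inl ` {i\<in>H. bx i = k} \<union> Inr ` {j. bu j = k}
        in card C = card R \<and> (\<forall>z\<in>Ut. sub_rank R C (jac g z) = card R)"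
    using blocks unfolding flat_triangular_blocks_def by blast
  have "\<forall>\<^sub>F z in nhds (xs, us). g (\<Phi>x (fst z), \<Phi>u z) = frechet_derivative \<Phi>x (at (fst z)) (f z) \<and>
      fbar (\<Phi>x (fst z), snd z) = frechet_derivative \<Phi>x (at (fst z)) (f z) \<and>
      local_diffeo_at (snd z) (\<lambda>u. \<Phi>u (fst z, u)) \<and> z \<in> Uu"
    using tr g fbar Uu unfolding state_input_transformation_def transformed_system_def
    by (intro eventually_conj) (auto intro: eventually_nhds_in_open)
  then obtain P where P: "open P" "(xs, us) \<in> P"
    and PP: "\<forall>z\<in>P. g (\<Phi>x (fst z), \<Phi>u z) = frechet_derivative \<Phi>x (at (fst z)) (f z) \<and>
      fbar (\<Phi>x (fst z), snd z) = frechet_derivative \<Phi>x (at (fst z)) (f z) \<and>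
      local_diffeo_at (snd z) (\<lambda>u. \<Phi>u (fst z, u)) \<and> z \<in> Uu"
    unfolding eventually_nhds by blast
  have P': "\<And>z. z \<in> P \<Longrightarrow> g (\<Phi>x (fst z), \<Phi>u z) = fbar (\<Phi>x (fst z), snd z)"
      "\<And>z. z \<in> P \<Longrightarrow> local_diffeo_at (snd z) (\<lambda>u. \<Phi>u (fst z, u))" "P \<subseteq> Uu"
    and P0: "fbar (\<Phi>x xs, us) = frechet_derivative \<Phi>x (at xs) (f (xs, us))"
    using PP P(2) by auto
  define \<kappa> :: "(real^'n) \<times> (real^'m) \<Rightarrow> (real^'n) \<times> (real^'m)" where "\<kappa> z = (\<Psi> (fst z), snd z)" for z
  define \<Theta> where "\<Theta> z = (fst z, \<Phi>u (\<kappa> z))" for z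
  have oT: "open (T \<times> (UNIV :: (real^'m) set))" using S by (intro open_Times) auto
  have \<kappa>s: "smooth_on (T \<times> UNIV) \<kappa>"
    unfolding \<kappa>_def
    by (intro smooth_on_Pair[OF oT] smooth_on_compose[OF oT \<Psi>s] smooth_on_linear[OF oT bounded_linear_fst]
        smooth_on_linear[OF oT bounded_linear_snd]) auto
  define U1 where "U1 = (T \<times> UNIV) \<inter> \<kappa> -` P"
  have oU1: "open U1"
    unfolding U1_def by (rule continuous_open_preimage[OF smooth_on_continuous[OF \<kappa>s] oT P(1)])
  have \<kappa>s1: "smooth_on U1 \<kappa>" by (rule smooth_on_subset[OF \<kappa>s]) (auto simp: U1_def)
  have \<Phi>\<kappa>s: "smooth_on U1 (\<lambda>z. \<Phi>u (\<kappa> z))"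
    by (rule smooth_on_compose[OF oU1 \<Phi>us \<kappa>s1]) (use P' in \<open>auto simp: U1_def\<close>)
  have \<Theta>s1: "smooth_on U1 \<Theta>"
    unfolding \<Theta>_def
    by (intro smooth_on_Pair[OF oU1] smooth_on_linear[OF oU1 bounded_linear_fst] \<Phi>\<kappa>s)
  define U where "U = U1 \<inter> \<Theta> -` (Ug \<inter> Ut)"
  have oU: "open U"
    unfolding U_def using Ug Ut by (intro continuous_open_preimage[OF smooth_on_continuous[OF \<Theta>s1] oU1] open_Int)
  have hom: "\<Phi>x xs \<in> T" "\<Psi> (\<Phi>x xs) = xs" "\<And>x. x \<in> T \<Longrightarrow> \<Phi>x (\<Psi> x) = x"
    using S by (auto simp: homeomorphism_def)
  have "\<kappa> (\<Phi>x xs, us) = (xs, us)" by (simp add: \<kappa>_def hom)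
  then have z0U: "(\<Phi>x xs, us) \<in> U"
    using P Ug Ut by (simp add: U_def U1_def \<Theta>_def hom)
  have \<Theta>s: "smooth_on U \<Theta>" by (rule smooth_on_subset[OF \<Theta>s1]) (auto simp: U_def)
  have g\<Theta>: "g (\<Theta> z) = fbar z" if "z \<in> U" for z
  proof -
    have z: "fst z \<in> T" "\<kappa> z \<in> P" using that by (auto simp: U_def U1_def)
    have "fst (\<kappa> z) = \<Psi> (fst z)" "snd (\<kappa> z) = snd z" by (simp_all add: \<kappa>_def)
    then show ?thesis
      using P'(1)[OF z(2)] hom(3)[OF z(1)] by (simp add: \<Theta>_def)
  qed
  have fs: "smooth_on U fbar"
  proof (rule smooth_on_cong[OF oU g\<Theta>])
    show "smooth_on U (\<lambda>z. g (\<Theta> z))"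
      by (rule smooth_on_compose[OF oU gs \<Theta>s]) (auto simp: U_def)
  qed
  have f0': "fbar (\<Phi>x xs, us) = 0"
    unfolding P0 f0 by (rule linear_0[OF has_derivative_linear[OF smooth_on_derivative[OF \<Phi>xs S(3)]]])
  have kernel: "(\<forall>i. k \<le> bx i \<longrightarrow> dx $ i = 0) \<and> (k = 0 \<longrightarrow> du = 0)"
    if z: "z \<in> U" and dH: "\<And>i. i \<notin> H \<Longrightarrow> dx $ i = 0"
      and rows: "\<And>i. k < bx i \<Longrightarrow> frechet_derivative fbar (at z) (dx, du) $ i = 0" for z k dx du
  proof -
    let ?Dg = "frechet_derivative g (at (\<Theta> z))"
    let ?D\<theta> = "frechet_derivative (\<lambda>z. \<Phi>u (\<kappa> z)) (at z)"
    have zz: "z \<in> U1" "\<Theta> z \<in> Ug" "\<Theta> z \<in> Ut" using z by (auto simp: U_def)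
    have D\<theta>: "((\<lambda>z. \<Phi>u (\<kappa> z)) has_derivative ?D\<theta>) (at z)"
      by (rule smooth_on_derivative[OF \<Phi>\<kappa>s zz(1)])
    have Dg: "(g has_derivative ?Dg) (at (\<Theta> z))"
      by (rule smooth_on_derivative[OF gs zz(2)])
    have "(\<Theta> has_derivative (\<lambda>d. (fst d, ?D\<theta> d))) (at z)"
      unfolding \<Theta>_def by (intro has_derivative_Pair D\<theta> has_derivative_fst has_derivative_ident)
    from has_derivative_compose[OF this Dg]
    have "((\<lambda>z. g (\<Theta> z)) has_derivative (\<lambda>d. ?Dg (fst d, ?D\<theta> d))) (at z)" .
    then have "(fbar has_derivative (\<lambda>d. ?Dg (fst d, ?D\<theta> d))) (at z)"
      by (rule has_derivative_transform_within_open[OF _ oU z g\<Theta>])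
    then have Df: "frechet_derivative fbar (at z) = (\<lambda>d. ?Dg (fst d, ?D\<theta> d))"
      by (rule frechet_derivative_at[symmetric])
    have tri: "(\<forall>i. k \<le> bx i \<longrightarrow> dx $ i = 0) \<and> (\<forall>j. k \<le> bu j \<longrightarrow> ?D\<theta> (dx, du) $ j = 0)"
    proof (rule triangular_kernel[OF labels Ut(1) zz(3) Dg _ _ dH])
      show "g (x, u) $ i = g (x', u') $ i" if "(x, u) \<in> Ut" "(x', u') \<in> Ut"
        "\<And>j. bx i \<le> bx j + 1 \<Longrightarrow> x $ j = x' $ j" "\<And>j. bx i \<le> bu j + 1 \<Longrightarrow> u $ j = u' $ j"
        for i x u x' u'
      proof -
        have "\<forall>v\<in>Ut. \<forall>w\<in>Ut. (\<forall>j. bx i \<le> bx j + 1 \<longrightarrow> fst v $ j = fst w $ j) \<longrightarrow>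
            (\<forall>j. bx i \<le> bu j + 1 \<longrightarrow> snd v $ j = snd w $ j) \<longrightarrow> g v $ i = g w $ i"
          using spec[OF dep, of i] unfolding case_prod_unfold prod.collapse .
        from bspec[OF bspec[OF this that(1)] that(2)] that(3,4) show ?thesis by simp
      qed
      show "sub_rank {i. bx i = l + 1} (Inl ` {i\<in>H. bx i = l} \<union> Inr ` {j. bu j = l}) (jac g (\<Theta> z))
        = card ((Inl ` {i\<in>H. bx i = l} \<union> Inr ` {j. bu j = l}) :: ('n + 'm) set)" if "l < p" for l
        using conjunct1[OF rank[rule_format, OF that, unfolded Let_def]]
          bspec[OF conjunct2[OF rank[rule_format, OF that, unfolded Let_def]] zz(3)] by (rule trans[OF _ sym, rotated])
      show "?Dg (dx, ?D\<theta> (dx, du)) $ i = 0" if "k < bx i" for i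
        using rows[OF that] by (simp add: Df)
    qed
    moreover have "du = 0" if "k = 0"
    proof -
      have "dx = 0" and \<theta>0: "?D\<theta> (dx, du) = 0" using tri that by (simp_all add: vec_eq_iff)
      have "((\<lambda>u. (fst z, u)) has_derivative (\<lambda>v. (0, v))) (at (snd z))"
        by (intro has_derivative_Pair has_derivative_const has_derivative_ident)
      from has_derivative_compose[OF this, of "\<lambda>z. \<Phi>u (\<kappa> z)" ?D\<theta>]
      have "((\<lambda>u. \<Phi>u (\<kappa> (fst z, u))) has_derivative (\<lambda>v. ?D\<theta> (0, v))) (at (snd z))"
        using D\<theta> by simp
      then have D: "((\<lambda>u. \<Phi>u (fst (\<kappa> z), u)) has_derivative (\<lambda>v. ?D\<theta> (0, v))) (at (snd (\<kappa> z)))"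
        by (simp add: \<kappa>_def)
      have "\<kappa> z \<in> P" using zz by (simp add: U1_def)
      from local_diffeo_at_kernel[OF P'(2)[OF this] D] show ?thesis
        using \<theta>0 \<open>dx = 0\<close> by simp
    qed
    ultimately show ?thesis by blast
  qed
  have "\<forall>z\<in>U. block_solvable H bx (frechet_derivative fbar (at z))"
    unfolding block_solvable_def by (intro ballI allI impI kernel) auto
  then show thesis
    by (rule that[OF oU z0U fs f0'])
qed

section \<open>State representations of the implicit Euler scheme\<close>

text \<open>The Euler equation says \<open>G (x', u) = (x, u)\<close> for \<open>G (x', u) = (x' - Ts \<phi> (x', u), u)\<close>. If \<open>Ts\<close> is smaller than the
inverse of a bound \<open>K\<close> for the derivative of the vector field, then \<open>dx = Ts D (dx, 0)\<close> is possible only for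
\<open>dx = 0\<close>, so \<open>G\<close> is a local diffeomorphism.\<close>

lemma state_representation_exists:
  fixes \<phi> :: "(real^'n) \<times> (real^'m) \<Rightarrow> real^'n"
  assumes U: "open U" "z0 \<in> U" and \<phi>: "smooth_on U \<phi>" and \<phi>0: "\<phi> z0 = 0"
  shows "\<exists>T0>0. \<forall>Ts. 0 < Ts \<and> Ts < T0 \<longrightarrow> (\<exists>h. state_representation Ts \<phi> z0 h)"
proof -
  let ?D = "frechet_derivative \<phi> (at z0)"
  have D: "(\<phi> has_derivative ?D) (at z0)" by (rule smooth_on_derivative[OF \<phi> U(2)])
  obtain K where K: "K > 0" "\<And>d. norm (?D d) \<le> norm d * K"
    using bounded_linear.pos_bounded[OF has_derivative_bounded_linear[OF D]] by blast
  have "\<exists>h. state_representation Ts \<phi> z0 h" if Ts: "0 < Ts" "Ts < 1 / K" for Ts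
  proof -
    define G where "G z = (fst z - Ts *\<^sub>R \<phi> z, snd z)" for z
    have Gs: "smooth_on U G"
      unfolding G_def
      by (intro smooth_on_Pair smooth_on_diff smooth_on_bounded_linear[OF U(1) bounded_linear_scaleR_right]
          smooth_on_linear[OF U(1) bounded_linear_fst] smooth_on_linear[OF U(1) bounded_linear_snd] \<phi> U)
    have "(G has_derivative (\<lambda>d. (fst d - Ts *\<^sub>R ?D d, snd d))) (at z0)"
      unfolding G_def
      by (intro has_derivative_Pair has_derivative_diff has_derivative_scaleR_right D
          has_derivative_fst has_derivative_snd has_derivative_ident)
    then have DG: "frechet_derivative G (at z0) = (\<lambda>d. (fst d - Ts *\<^sub>R ?D d, snd d))"
      by (rule frechet_derivative_at[symmetric])
    have "linear (frechet_derivative G (at z0))"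
      by (rule has_derivative_linear[OF smooth_on_derivative[OF Gs U(2)]])
    moreover have "d = 0" if "frechet_derivative G (at z0) d = 0" for d
    proof -
      have "snd d = 0" and d1: "fst d = Ts *\<^sub>R ?D d" using that by (simp_all add: DG prod_eq_iff)
      then have "norm d = norm (fst d)" by (cases d) (simp add: norm_Pair)
      also have "\<dots> \<le> Ts * (norm d * K)"
        unfolding d1 using K(2)[of d] Ts by (simp add: mult_left_mono)
      finally have "norm d * (1 - Ts * K) \<le> 0" by (simp add: algebra_simps)
      moreover have "1 - Ts * K > 0" using Ts K by (simp add: field_simps)
      ultimately have "norm d \<le> 0" by (simp add: mult_le_0_iff)
      then show ?thesis by simp
    qed
    ultimately have "inj (frechet_derivative G (at z0))"
      by (simp add: linear_injective_0)
    then obtain S T Q where S: "open S" "z0 \<in> S" "S \<subseteq> U" "open T" "G z0 \<in> T" "homeomorphism S T G Q"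
      and Q: "smooth_on T Q"
      by (rule smooth_inverse_function[OF U Gs])
    have GQ: "\<And>w. w \<in> T \<Longrightarrow> Q w \<in> S \<and> G (Q w) = w" and QG: "\<And>z. z \<in> S \<Longrightarrow> G z \<in> T \<and> Q (G z) = z"
      using S(6) by (auto simp: homeomorphism_def)
    have G0: "G z0 = z0" by (simp add: G_def \<phi>0)
    obtain V W where VW: "open V" "open W" "fst z0 \<in> V" "snd z0 \<in> W" "V \<times> W \<subseteq> S"
    proof -
      obtain V W where "open V" "open W" "z0 \<in> V \<times> W" "V \<times> W \<subseteq> S"
        using open_prod_elim[OF S(1,2)] by blast
      then show ?thesis using that[of V W] by (simp add: mem_Times_iff)
    qed
    show ?thesis
      unfolding state_representation_def
    proof (intro exI conjI)
      show "open (T \<inter> UNIV \<times> W)" using S VW by (intro open_Int open_Times) auto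
      show "z0 \<in> T \<inter> UNIV \<times> W" using S(5) G0 VW by (simp add: mem_Times_iff)
      show "open V" "fst z0 \<in> V" by fact+
      show "smooth_on (T \<inter> UNIV \<times> W) (\<lambda>z. fst (Q z))"
        by (rule smooth_on_subset[OF smooth_on_bounded_linear[OF S(4) bounded_linear_fst Q]]) auto
      have "x' = x + Ts *\<^sub>R \<phi> (x', u) \<longleftrightarrow> x' = fst (Q (x, u))"
        if "(x, u) \<in> T" "u \<in> W" "x' \<in> V" for x u x'
      proof
        assume eq: "x' = x + Ts *\<^sub>R \<phi> (x', u)"
        then have "x' - Ts *\<^sub>R \<phi> (x', u) = x" unfolding diff_eq_eq .
        then have "G (x', u) = (x, u)" by (simp add: G_def)
        moreover have "(x', u) \<in> S" using VW that by auto
        ultimately have "Q (x, u) = (x', u)" using QG[of "(x', u)"] by simp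
        then show "x' = fst (Q (x, u))" by simp
      next
        assume x': "x' = fst (Q (x, u))"
        have "G (Q (x, u)) = (x, u)" using GQ that by blast
        then have "snd (Q (x, u)) = u" and x: "fst (Q (x, u)) - Ts *\<^sub>R \<phi> (Q (x, u)) = x"
          by (simp_all add: G_def)
        then have "Q (x, u) = (x', u)" using x' by (simp add: prod_eq_iff)
        with x show "x' = x + Ts *\<^sub>R \<phi> (x', u)" by auto
      qed
      then show "\<forall>(x, u)\<in>T \<inter> UNIV \<times> W. \<forall>x'\<in>V. (x' = x + Ts *\<^sub>R \<phi> (x', u)) = (x' = fst (Q (x, u)))"
        by blast
    qed
  qed
  then show ?thesis using K(1) by (intro exI[of _ "1 / K"]) auto
qed

text \<open>Differentiating \<open>h (x, u) = x + Ts \<phi> (h (x, u), u)\<close> in direction \<open>(dx, 0)\<close> shows that \<open>Dh (dx, 0) = 0\<close> implies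
\<open>dx = 0\<close>. So \<open>dx \<mapsto> Dh (dx, 0)\<close> is injective, hence onto, for every \<open>Ts\<close>.\<close>

lemma state_representation_submersive:
  fixes \<phi> h :: "(real^'n) \<times> (real^'m) \<Rightarrow> real^'n"
  assumes U: "open U" "z0 \<in> U" and \<phi>: "smooth_on U \<phi>" and \<phi>0: "\<phi> z0 = 0"
    and rep: "state_representation Ts \<phi> z0 h"
  shows "\<forall>\<^sub>F z in nhds z0. rank (jac h z) = CARD('n)"
proof -
  obtain Uh V where Uh: "open Uh" "z0 \<in> Uh" "open V" "fst z0 \<in> V" and hs: "smooth_on Uh h"
    and iff: "\<And>x u x'. (x, u) \<in> Uh \<Longrightarrow> x' \<in> V \<Longrightarrow> x' = x + Ts *\<^sub>R \<phi> (x', u) \<longleftrightarrow> x' = h (x, u)"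
    using rep unfolding state_representation_def by blast
  have h0: "h z0 = fst z0"
    using iff[of "fst z0" "snd z0" "fst z0"] Uh \<phi>0 by simp
  define W where "W = (Uh \<inter> h -` V) \<inter> (Uh \<inter> (\<lambda>z. (h z, snd z)) -` U)"
  have "continuous_on Uh (\<lambda>z. (h z, snd z))"
    by (intro continuous_intros smooth_on_continuous[OF hs])
  then have W: "open W"
    unfolding W_def
    by (intro open_Int continuous_open_preimage smooth_on_continuous[OF hs] Uh U)
  have "z0 \<in> W" using Uh U h0 by (simp add: W_def)
  moreover have "rank (jac h z) = CARD('n)" if z: "z \<in> W" for z
  proof -
    have zW: "z \<in> Uh" "h z \<in> V" "(h z, snd z) \<in> U" using z by (auto simp: W_def)
    let ?Dh = "frechet_derivative h (at z)" and ?D = "frechet_derivative \<phi> (at (h z, snd z))"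
    have Dh: "(h has_derivative ?Dh) (at z)" by (rule smooth_on_derivative[OF hs zW(1)])
    have D\<phi>: "(\<phi> has_derivative ?D) (at (h z, snd z))" by (rule smooth_on_derivative[OF \<phi> zW(3)])
    have "((\<lambda>z. (h z, snd z)) has_derivative (\<lambda>d. (?Dh d, snd d))) (at z)"
      by (intro has_derivative_Pair Dh has_derivative_snd has_derivative_ident)
    from has_derivative_compose[OF this D\<phi>]
    have "((\<lambda>z. fst z + Ts *\<^sub>R \<phi> (h z, snd z)) has_derivative
        (\<lambda>d. fst d + Ts *\<^sub>R ?D (?Dh d, snd d))) (at z)"
      by (intro has_derivative_add has_derivative_fst has_derivative_ident has_derivative_scaleR_right)
    then have "(h has_derivative (\<lambda>d. fst d + Ts *\<^sub>R ?D (?Dh d, snd d))) (at z)"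
    proof (rule has_derivative_transform_within_open[OF _ W z])
      fix z assume "z \<in> W"
      then show "fst z + Ts *\<^sub>R \<phi> (h z, snd z) = h z"
        using iff[of "fst z" "snd z" "h z"] by (simp add: W_def)
    qed
    from has_derivative_unique[OF Dh this]
    have Dh_eq: "?Dh d = fst d + Ts *\<^sub>R ?D (?Dh d, snd d)" for d by metis
    have linDh: "linear ?Dh" and lin: "linear ?D"
      using Dh D\<phi> by (auto intro: has_derivative_linear)
    define L where "L dx = ?Dh (dx, 0)" for dx
    have "linear (\<lambda>dx::real^'n. (dx, 0::real^'m))"
      by (rule linearI) (simp_all)
    from linear_compose[OF this linDh] have "linear L"
      by (simp add: L_def[abs_def] comp_def)
    moreover have "dx = 0" if "L dx = 0" for dx
      using Dh_eq[of "(dx, 0)"] that linear_0[OF lin] by (simp add: L_def zero_prod_def)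
    ultimately have "surj L"
      by (simp add: linear_injective_0 linear_injective_imp_surjective)
    have "surj ((*v) (jac h z))"
    proof (rule surjI)
      fix y
      show "jac h z *v (\<chi> j. case j of Inl a \<Rightarrow> (inv L y) $ a | Inr b \<Rightarrow> (0::real^'m) $ b) = y"
        unfolding jac_mult[OF has_derivative_bounded_linear[OF Dh]]
        using surj_f_inv_f[OF \<open>surj L\<close>] by (simp add: L_def)
    qed
    then show ?thesis by (simp add: full_rank_surjective)
  qed
  ultimately show ?thesis
    using W by (auto simp: eventually_nhds)
qed

section \<open>The flat output and the chart that it induces\<close>

text \<open>The shift by one label between \<open>d\<close> and the solution is what makes the fixed point iteration for the
state terminate.\<close>

definition block_causal ::
  "('n \<Rightarrow> nat) \<Rightarrow> ((real^'n) \<times> (real^'m)) set \<Rightarrow> ((real^'n) \<times> (real^'m) \<Rightarrow> (real^'n) \<times> (real^'m)) \<Rightarrow> bool"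
where
  "block_causal bx T N \<longleftrightarrow>
     (\<forall>k d d' y. (d, y) \<in> T \<longrightarrow> (d', y) \<in> T \<longrightarrow> (\<forall>i. k < bx i \<longrightarrow> d $ i = d' $ i) \<longrightarrow>
        (\<forall>i. k \<le> bx i \<longrightarrow> fst (N (d, y)) $ i = fst (N (d', y)) $ i))"

text \<open>\<open>N\<close> is the local inverse of \<open>M z = (\<phi> z, \<pi> (fst z))\<close>. Its derivative maps \<open>(e, 0)\<close> to some \<open>(dx, du)\<close> with
\<open>\<pi> dx = 0\<close> and \<open>D\<phi> (dx, du) = e\<close>, so \<open>block_solvable\<close> yields the infinitesimal form of \<open>block_causal\<close>.
Integrating it along the segment from \<open>(d, y)\<close> to \<open>(d', y)\<close> requires a convex domain; \<open>T\<close> is a ball.\<close>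

lemma flat_output_chart:
  fixes \<phi> :: "(real^'n) \<times> (real^'m) \<Rightarrow> real^'n" and bx :: "'n \<Rightarrow> nat"
  assumes U: "open U" "z0 \<in> U" and \<phi>: "smooth_on U \<phi>" and \<phi>0: "\<phi> z0 = 0"
    and solv: "\<forall>z\<in>U. block_solvable H bx (frechet_derivative \<phi> (at z))"
    and H: "card (- H) = CARD('m)"
  obtains \<pi> :: "real^'n \<Rightarrow> real^'m" and S T N where "bounded_linear \<pi>"
    "open S" "z0 \<in> S" "S \<subseteq> U" "open T" "(0, \<pi> (fst z0)) \<in> T" "smooth_on T N"
    "\<forall>z\<in>S. (\<phi> z, \<pi> (fst z)) \<in> T \<and> N (\<phi> z, \<pi> (fst z)) = z"
    "\<forall>w\<in>T. N w \<in> S \<and> \<phi> (N w) = fst w \<and> \<pi> (fst (N w)) = snd w"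
    "block_causal bx T N"
proof -
  have kernel: "(\<forall>i. k \<le> bx i \<longrightarrow> dx $ i = 0) \<and> (k = 0 \<longrightarrow> du = 0)"
    if "z \<in> U" "\<And>i. i \<notin> H \<Longrightarrow> dx $ i = 0" "\<And>i. k < bx i \<Longrightarrow> frechet_derivative \<phi> (at z) (dx, du) $ i = 0"
    for z k dx du
    using bspec[OF solv that(1)] that(2,3) unfolding block_solvable_def by blast
  obtain \<sigma> :: "'m \<Rightarrow> 'n" where \<sigma>: "bij_betw \<sigma> UNIV (- H)"
    using finite_same_card_bij[of "UNIV :: 'm set" "- H"] H by auto
  define \<pi> :: "real^'n \<Rightarrow> real^'m" where "\<pi> x = (\<chi> j. x $ \<sigma> j)" for x
  have \<pi>: "bounded_linear \<pi>"
    unfolding linear_conv_bounded_linear[symmetric] by (rule linearI) (simp_all add: \<pi>_def vec_eq_iff)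
  have \<pi>H: "dx $ i = 0" if "\<pi> dx = 0" "i \<notin> H" for dx i
  proof -
    obtain j where "i = \<sigma> j" using \<sigma> \<open>i \<notin> H\<close> by (auto simp: bij_betw_def)
    then show ?thesis using that(1) by (simp add: \<pi>_def vec_eq_iff)
  qed
  define M where "M z = (\<phi> z, \<pi> (fst z))" for z
  have Ms: "smooth_on U M"
    unfolding M_def
    by (intro smooth_on_Pair smooth_on_bounded_linear[OF U(1) \<pi>] smooth_on_linear[OF U(1) bounded_linear_fst] \<phi> U)
  have DM: "(M has_derivative (\<lambda>d. (frechet_derivative \<phi> (at z) d, \<pi> (fst d)))) (at z)" if "z \<in> U" for z
    unfolding M_def
    by (intro has_derivative_Pair smooth_on_derivative[OF \<phi> that] bounded_linear.has_derivative[OF \<pi>]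
        has_derivative_fst has_derivative_ident)
  have "d = 0" if "frechet_derivative M (at z0) d = 0" for d
  proof -
    have *: "frechet_derivative \<phi> (at z0) (fst d, snd d) = 0" "\<pi> (fst d) = 0"
      using that frechet_derivative_at[OF DM[OF U(2)], symmetric] by (simp_all add: zero_prod_def)
    have "(\<forall>i. 0 \<le> bx i \<longrightarrow> fst d $ i = 0) \<and> ((0::nat) = 0 \<longrightarrow> snd d = 0)"
      by (rule kernel[OF U(2)]) (use * \<pi>H in auto)
    then show ?thesis by (simp add: prod_eq_iff vec_eq_iff)
  qed
  then have "inj (frechet_derivative M (at z0))"
    using linear_injective_0[OF has_derivative_linear[OF smooth_on_derivative[OF Ms U(2)]]] by blast
  then obtain S0 T0 N where S0: "open S0" "z0 \<in> S0" "S0 \<subseteq> U" "open T0" "M z0 \<in> T0" "homeomorphism S0 T0 M N"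
    and Ns: "smooth_on T0 N"
    by (rule smooth_inverse_function[OF U Ms])
  have M0: "M z0 = (0, \<pi> (fst z0))" by (simp add: M_def \<phi>0)
  obtain \<rho> where \<rho>: "\<rho> > 0" "ball (M z0) \<rho> \<subseteq> T0"
    using S0 openE by blast
  define T where "T = ball (M z0) \<rho>"
  have T: "open T" "T \<subseteq> T0" "M z0 \<in> T" "convex T" using \<rho> by (auto simp: T_def)
  define S where "S = S0 \<inter> M -` T"
  have S: "open S"
    unfolding S_def by (rule continuous_open_preimage[OF smooth_on_continuous[OF smooth_on_subset[OF Ms S0(3)]] S0(1) T(1)])
  have NM: "M z \<in> T \<and> N (M z) = z" if "z \<in> S" for z
    using that S0(6) by (auto simp: S_def homeomorphism_def)
  have MN: "N w \<in> S \<and> M (N w) = w" if "w \<in> T" for w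
    using that S0(6) T(2) by (auto simp: S_def homeomorphism_def)
  have NsT: "smooth_on T N" by (rule smooth_on_subset[OF Ns T(2)])
  have DN: "fst (frechet_derivative N (at w) (e, 0)) $ i = 0"
    if w: "w \<in> T" and e: "\<And>i. k < bx i \<Longrightarrow> e $ i = 0" and i: "k \<le> bx i" for w e k i
  proof -
    let ?d = "frechet_derivative N (at w) (e, 0)"
    have NwU: "N w \<in> U" using MN[OF w] S0(3) by (auto simp: S_def)
    have "((\<lambda>w. M (N w)) has_derivative
        (\<lambda>v. (frechet_derivative \<phi> (at (N w)) (frechet_derivative N (at w) v), \<pi> (fst (frechet_derivative N (at w) v))))) (at w)"
      by (rule has_derivative_compose[OF smooth_on_derivative[OF NsT w] DM[OF NwU]])
    then have "((\<lambda>w. w) has_derivative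
        (\<lambda>v. (frechet_derivative \<phi> (at (N w)) (frechet_derivative N (at w) v), \<pi> (fst (frechet_derivative N (at w) v))))) (at w)"
      by (rule has_derivative_transform_within_open[OF _ T(1) w]) (use MN in blast)
    from fun_cong[OF has_derivative_unique[OF this has_derivative_ident], of "(e, 0)"]
    have *: "frechet_derivative \<phi> (at (N w)) (fst ?d, snd ?d) = e" "\<pi> (fst ?d) = 0"
      by simp_all
    have "(\<forall>i. k \<le> bx i \<longrightarrow> fst ?d $ i = 0) \<and> (k = 0 \<longrightarrow> snd ?d = 0)"
      by (rule kernel[OF NwU \<pi>H[OF *(2)]]) (assumption, simp only: *(1) e)
    then show ?thesis using i by blast
  qed
  have tri: "fst (N (d, y)) $ i = fst (N (d', y)) $ i"
    if T1: "(d, y) \<in> T" and T2: "(d', y) \<in> T" and agree: "\<And>i. k < bx i \<Longrightarrow> d $ i = d' $ i" and i: "k \<le> bx i"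
    for k d d' y i
  proof -
    define \<gamma> where "\<gamma> t = (d + t *\<^sub>R (d' - d), y)" for t :: real
    have \<gamma>T: "\<gamma> t \<in> T" if "t \<in> {0..1}" for t
    proof -
      have "\<gamma> t = (1 - t) *\<^sub>R (d, y) + t *\<^sub>R (d', y)"
        by (simp add: \<gamma>_def algebra_simps)
      then show ?thesis using convexD[OF T(4) T1 T2, of "1 - t" t] that by simp
    qed
    have "((\<lambda>t. fst (N (\<gamma> t)) $ i) has_derivative (\<lambda>h. 0)) (at t within {0..1})" if t: "t \<in> {0..1}" for t
    proof -
      have "(\<gamma> has_derivative (\<lambda>h. (h *\<^sub>R (d' - d), 0))) (at t)"
        unfolding \<gamma>_def by (auto intro!: derivative_eq_intros)
      from has_derivative_compose[OF this smooth_on_derivative[OF NsT \<gamma>T[OF t]]]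
      have "((\<lambda>t. N (\<gamma> t)) has_derivative (\<lambda>h. frechet_derivative N (at (\<gamma> t)) (h *\<^sub>R (d' - d), 0))) (at t)" .
      from bounded_linear.has_derivative[OF bounded_linear_vec_nth has_derivative_fst[OF this]]
      have "((\<lambda>t. fst (N (\<gamma> t)) $ i) has_derivative
          (\<lambda>h. fst (frechet_derivative N (at (\<gamma> t)) (h *\<^sub>R (d' - d), 0)) $ i)) (at t)" .
      moreover have "fst (frechet_derivative N (at (\<gamma> t)) (h *\<^sub>R (d' - d), 0)) $ i = 0" for h
        by (rule DN[OF \<gamma>T[OF t] _ i]) (simp add: agree)
      ultimately have "((\<lambda>t. fst (N (\<gamma> t)) $ i) has_derivative (\<lambda>h. 0)) (at t)" by simp
      then show ?thesis by (rule has_derivative_at_withinI)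
    qed
    from has_derivative_zero_constant[OF convex_closed_interval this]
    obtain c where "\<And>t. t \<in> {0..1} \<Longrightarrow> fst (N (\<gamma> t)) $ i = c" by blast
    from this[of 0] this[of 1] show ?thesis by (simp add: \<gamma>_def)
  qed
  show thesis
  proof (rule that[OF \<pi> S _ _ T(1) _ NsT])
    show "z0 \<in> S" "S \<subseteq> U" using S0 T(3) by (auto simp: S_def)
    show "(0, \<pi> (fst z0)) \<in> T" using T(3) M0 by simp
    show "\<forall>z\<in>S. (\<phi> z, \<pi> (fst z)) \<in> T \<and> N (\<phi> z, \<pi> (fst z)) = z"
      using NM by (simp add: M_def)
    show "\<forall>w\<in>T. N w \<in> S \<and> \<phi> (N w) = fst w \<and> \<pi> (fst (N w)) = snd w"
      using MN by (simp add: M_def prod_eq_iff)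
    show "block_causal bx T N"
      unfolding block_causal_def
    proof (intro allI impI)
      fix k d d' y i
      assume "(d, y) \<in> T" "(d', y) \<in> T" and agree: "\<forall>i. k < bx i \<longrightarrow> d $ i = d' $ i" and "k \<le> bx i"
      then show "fst (N (d, y)) $ i = fst (N (d', y)) $ i"
        using tri[OF _ _ agree[rule_format]] by blast
    qed
  qed
qed

section \<open>Reconstruction of the state from the flat output\<close>

text \<open>\<open>flat_state N Ts x0 s\<close> is the \<open>s\<close>-th iterate, from the constant sequence \<open>x0\<close>, for the fixed point equation
\<open>x t = fst (N ((x t - x (t - 1)) / Ts, y t))\<close> of the state sequence. At time \<open>t\<close> it involves the entries
\<open>y (t - s + 1), \<dots>, y t\<close>.\<close>

primrec flat_state ::
  "((real^'n) \<times> (real^'m) \<Rightarrow> (real^'n) \<times> (real^'m)) \<Rightarrow> real \<Rightarrow> real^'n \<Rightarrow> nat \<Rightarrow> int \<Rightarrow> (int \<Rightarrow> real^'m) \<Rightarrow> real^'n"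
where
  "flat_state N Ts x0 0 t y = x0"
| "flat_state N Ts x0 (Suc s) t y =
     fst (N ((flat_state N Ts x0 s t y - flat_state N Ts x0 s (t - 1) y) /\<^sub>R Ts, y t))"

lemma flat_state_shift: "flat_state N Ts x0 s t (\<lambda>i. y (k + i)) = flat_state N Ts x0 s (k + t) y"
  by (induction s arbitrary: t) (simp_all add: algebra_simps)

lemma flat_state_cong:
  "(\<And>j. t - int s < j \<Longrightarrow> j \<le> t \<Longrightarrow> y j = y' j) \<Longrightarrow> flat_state N Ts x0 s t y = flat_state N Ts x0 s t y'"
proof (induction s arbitrary: t)
  case (Suc s)
  have "flat_state N Ts x0 s t y = flat_state N Ts x0 s t y'"
    "flat_state N Ts x0 s (t - 1) y = flat_state N Ts x0 s (t - 1) y'"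
    by (rule Suc.IH; use Suc.prems in simp)+
  moreover have "y t = y' t" using Suc.prems by simp
  ultimately show ?case by simp
qed simp

lemma flat_state_const:
  "N (0, y0) = (x0, u0) \<Longrightarrow> flat_state N Ts x0 s t (\<lambda>_. y0) = x0"
  by (induction s arbitrary: t) auto

text \<open>The domain of \<open>N\<close> contains difference quotients with the fixed denominator \<open>Ts\<close> only if the iterates stay close
enough to \<open>x0\<close>. The formulation with a filter allows to treat finitely many \<open>s\<close> with one radius.\<close>

lemma flat_state_close:
  assumes N: "isCont N (0, y0)" and N0: "N (0, y0) = (x0, u0)" and Ts: "Ts > 0" and "\<epsilon> > 0"
  shows "\<forall>\<^sub>F \<delta> in at_right 0. \<forall>t y. (\<forall>j. t - int s < j \<and> j \<le> t \<longrightarrow> y j \<in> ball y0 \<delta>) \<longrightarrow>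
    flat_state N Ts x0 s t y \<in> ball x0 \<epsilon>"
  using \<open>\<epsilon> > 0\<close>
proof (induction s arbitrary: \<epsilon>)
  case (Suc s)
  obtain \<eta> where \<eta>: "\<eta> > 0" "\<And>w. dist w (0, y0) < \<eta> \<Longrightarrow> dist (N w) (N (0, y0)) < \<epsilon>"
    using N Suc.prems unfolding continuous_at_eps_delta by blast
  have "\<forall>\<^sub>F \<delta> in at_right 0. \<forall>t y. (\<forall>j. t - int s < j \<and> j \<le> t \<longrightarrow> y j \<in> ball y0 \<delta>) \<longrightarrow>
      flat_state N Ts x0 s t y \<in> ball x0 (Ts * \<eta> / 4)"
    by (rule Suc.IH) (use \<eta> Ts in simp)
  moreover have "\<forall>\<^sub>F \<delta> in at_right 0. \<delta> < \<eta> / 2"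
    by (rule eventually_at_right_real[of 0 "\<eta> / 2", THEN eventually_mono]) (use \<eta> in auto)
  ultimately show ?case
  proof eventually_elim
    case (elim \<delta>)
    show ?case
    proof (intro allI impI)
      fix t y assume y: "\<forall>j. t - int (Suc s) < j \<and> j \<le> t \<longrightarrow> y j \<in> ball y0 \<delta>"
      let ?a = "flat_state N Ts x0 s t y" and ?b = "flat_state N Ts x0 s (t - 1) y"
      have "?a \<in> ball x0 (Ts * \<eta> / 4)" "?b \<in> ball x0 (Ts * \<eta> / 4)" "y t \<in> ball y0 \<delta>"
        using elim(1) y by auto
      then have ab: "dist x0 ?a < Ts * \<eta> / 4" "dist x0 ?b < Ts * \<eta> / 4" "dist y0 (y t) < \<eta> / 2"
        using elim(2) by auto
      then have "dist ?a ?b < Ts * \<eta> / 2"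
        using dist_triangle3[of ?a ?b x0] by simp
      then have "norm ((?a - ?b) /\<^sub>R Ts) < \<eta> / 2"
        using Ts by (simp add: dist_norm divide_inverse_commute[symmetric] divide_less_eq mult.commute)
      then have "dist ((?a - ?b) /\<^sub>R Ts, y t) (0, y0) < \<eta>"
        using norm_Pair_le[of "(?a - ?b) /\<^sub>R Ts" "y t - y0"] ab(3) by (simp add: dist_norm norm_minus_commute)
      from \<eta>(2)[OF this]
      have "dist (N ((?a - ?b) /\<^sub>R Ts, y t)) (x0, u0) < \<epsilon>" by (simp add: N0)
      from le_less_trans[OF dist_fst_le this]
      show "flat_state N Ts x0 (Suc s) t y \<in> ball x0 \<epsilon>" by (simp add: dist_commute)
    qed
  qed
qed simp

text \<open>After \<open>s\<close> steps, two iterations driven by the same \<open>y\<close> agree in the blocks with label \<open>> p - s\<close>, wherever their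
starting sequences come from. This is applied to \<open>flat_state\<close> and a trajectory of the system (a
constant iteration), and to \<open>flat_state\<close> and its own successor. The time interval shrinks from the left
by one in each step because of the difference quotient.\<close>

lemma iteration_agreement:
  fixes N :: "(real^'n) \<times> (real^'m) \<Rightarrow> (real^'n) \<times> (real^'m)" and bx :: "'n \<Rightarrow> nat"
  assumes tri: "block_causal bx T N"
    and bx: "\<And>i. 1 \<le> bx i" "\<And>i. bx i \<le> p"
    and A: "\<And>s t. s < p \<Longrightarrow> a + int s < t \<Longrightarrow> t \<le> b \<Longrightarrow> ((A s t - A s (t - 1)) /\<^sub>R Ts, y t) \<in> T \<and>
        A (Suc s) t = fst (N ((A s t - A s (t - 1)) /\<^sub>R Ts, y t))"
    and B: "\<And>s t. s < p \<Longrightarrow> a + int s < t \<Longrightarrow> t \<le> b \<Longrightarrow> ((B s t - B s (t - 1)) /\<^sub>R Ts, y t) \<in> T \<and>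
        B (Suc s) t = fst (N ((B s t - B s (t - 1)) /\<^sub>R Ts, y t))"
    and t: "a + int p \<le> t" "t \<le> b"
  shows "A p t = B p t"
proof -
  have "A s t $ i = B s t $ i" if "s \<le> p" "a + int s \<le> t" "t \<le> b" "p < bx i + s" for s t i
    using that
  proof (induction s arbitrary: t i)
    case 0
    then show ?case using bx(2)[of i] by simp
  next
    case (Suc s)
    have s: "s < p" "a + int s < t" "t \<le> b" using Suc.prems by auto
    have "((A s t - A s (t - 1)) /\<^sub>R Ts) $ i = ((B s t - B s (t - 1)) /\<^sub>R Ts) $ i" if "p - s < bx i" for i
      using Suc.IH[of t i] Suc.IH[of "t - 1" i] that Suc.prems by simp
    then have agree: "\<forall>i. p - s < bx i \<longrightarrow> ((A s t - A s (t - 1)) /\<^sub>R Ts) $ i = ((B s t - B s (t - 1)) /\<^sub>R Ts) $ i"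
      by blast
    have "p - s \<le> bx i" using Suc.prems by simp
    then have "fst (N ((A s t - A s (t - 1)) /\<^sub>R Ts, y t)) $ i = fst (N ((B s t - B s (t - 1)) /\<^sub>R Ts, y t)) $ i"
      using tri conjunct1[OF A[OF s]] conjunct1[OF B[OF s]] agree unfolding block_causal_def by blast
    then show ?case using A[OF s] B[OF s] by simp
  qed
  from this[of p t] t bx(1) show ?thesis by (simp add: vec_eq_iff Suc_le_eq)
qed

lemma window_Ck_on_flat_state:
  assumes W: "window_open I W" and N: "smooth_on T N"
    and arg: "\<And>s t w. w \<in> W \<Longrightarrow> s < q \<Longrightarrow> {t - int s - 1<..t} \<subseteq> I \<Longrightarrow>
        ((flat_state N Ts x0 s t w - flat_state N Ts x0 s (t - 1) w) /\<^sub>R Ts, w t) \<in> T"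
    and "s \<le> q" "{t - int s<..t} \<subseteq> I"
  shows "window_Ck_on k I W (flat_state N Ts x0 s t)"
  using assms(4,5)
proof (induction s arbitrary: t)
  case 0
  then show ?case by (simp add: window_Ck_on_const[OF W])
next
  case (Suc s)
  have sub: "{t - int s - 1<..t} \<subseteq> I" using Suc.prems(2) by (simp add: algebra_simps)
  have "window_Ck_on k I W (flat_state N Ts x0 s t)"
    by (rule Suc.IH) (use Suc.prems sub in auto)
  moreover have "window_Ck_on k I W (flat_state N Ts x0 s (t - 1))"
    by (rule Suc.IH) (use Suc.prems sub in auto)
  ultimately have "window_Ck_on k I W (\<lambda>w. ((flat_state N Ts x0 s t w - flat_state N Ts x0 s (t - 1) w) /\<^sub>R Ts, w t))"
    by (intro window_Ck_on_Pair[OF W] window_Ck_on_bounded_linear[OF W bounded_linear_scaleR_right]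
        window_Ck_on_diff[OF W] window_Ck_on_entry[OF W])
  then have "window_Ck_on k I W (\<lambda>w. N ((flat_state N Ts x0 s t w - flat_state N Ts x0 s (t - 1) w) /\<^sub>R Ts, w t))"
    by (rule window_Ck_on_compose[OF W N[unfolded smooth_on_def, rule_format]])
       (rule arg[OF _ _ sub], use Suc.prems in auto)
  from window_Ck_on_bounded_linear[OF W bounded_linear_fst this]
  show ?case by (simp add: fun_eq_iff)
qed

section \<open>Flatness\<close>

lemma ball_Pair_half:
  fixes a d :: "'a::real_normed_vector" and b y :: "'b::real_normed_vector"
  assumes "d \<in> ball a (r / 2)" "y \<in> ball b (r / 2)"
  shows "(d, y) \<in> ball (a, b) r"
proof -
  have "dist (a, b) (d, y) \<le> dist a d + dist b y"
    using norm_Pair_le[of "a - d" "b - y"] by (simp add: dist_norm)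
  then show ?thesis using assms by simp
qed

text \<open>With \<open>X s t\<close> for the iterates, the state and the input are recovered from the output sequence \<open>y\<close> by
\<open>F y = (X p 0, snd (N ((X p 1 - X p 0) / Ts, y 1)))\<close>, and the output is \<open>\<pi>\<close> of the current state; so \<open>r1 = p\<close>, \<open>r2 = 1\<close>, \<open>q1 = q2 = 0\<close>. For
an arbitrary sequence \<open>y\<close>, the iteration is stationary after \<open>p\<close> steps, so \<open>X p\<close> solves the fixed point
equation; applying \<open>(\<phi>, \<pi>)\<close>, the inverse of \<open>N\<close>, recovers both the Euler equation and \<open>y\<close>. Conversely, a
trajectory solves the fixed point equation for its own output and so agrees with \<open>X p\<close>.\<close>

lemma implicit_euler_flat:
  fixes \<phi> h :: "(real^'n) \<times> (real^'m) \<Rightarrow> real^'n" and bx :: "'n \<Rightarrow> nat"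
  assumes U: "open U" "z0 \<in> U" and \<phi>: "smooth_on U \<phi>" and \<phi>0: "\<phi> z0 = 0"
    and solv: "\<forall>z\<in>U. block_solvable H bx (frechet_derivative \<phi> (at z))"
    and H: "card (- H) = CARD('m)" and bx: "\<And>i. 1 \<le> bx i" "\<And>i. bx i \<le> p"
    and Ts: "Ts > 0" and rep: "state_representation Ts \<phi> z0 h"
  shows "discrete_flat_at h z0"
proof -
  obtain x0 u0 where z0: "z0 = (x0, u0)" by fastforce
  obtain Uh V where Uh: "open Uh" "z0 \<in> Uh" "open V" "fst z0 \<in> V"
    and rep': "\<forall>(x, u)\<in>Uh. \<forall>x'\<in>V. x' = x + Ts *\<^sub>R \<phi> (x', u) \<longleftrightarrow> x' = h (x, u)"
    using rep unfolding state_representation_def by blast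
  have iff: "x' = x + Ts *\<^sub>R \<phi> (x', u) \<longleftrightarrow> x' = h (x, u)" if "(x, u) \<in> Uh" "x' \<in> V" for x u x'
    using bspec[OF rep' that(1), unfolded prod.case] that(2) by (rule bspec)
  obtain r where r: "r > 0" "ball z0 r \<subseteq> Uh" "ball x0 r \<subseteq> V"
  proof -
    obtain a where a: "a > 0" "ball z0 a \<subseteq> Uh" by (rule openE[OF Uh(1,2)])
    obtain b where b: "b > 0" "ball (fst z0) b \<subseteq> V" by (rule openE[OF Uh(3,4)])
    show thesis
      by (rule that[of "min a b"]) (use a b in \<open>auto simp: z0\<close>)
  qed
  have U': "open (U \<inter> ball z0 (r / 2))" "z0 \<in> U \<inter> ball z0 (r / 2)"
    using U r by auto
  have solv': "\<forall>z\<in>U \<inter> ball z0 (r / 2). block_solvable H bx (frechet_derivative \<phi> (at z))"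
    using solv by blast
  obtain \<pi> :: "real^'n \<Rightarrow> real^'m" and S T N where \<pi>: "bounded_linear \<pi>"
    and S: "open S" "z0 \<in> S" "S \<subseteq> U \<inter> ball z0 (r / 2)"
    and T: "open T" "(0, \<pi> (fst z0)) \<in> T" and N: "smooth_on T N"
    and NM: "\<forall>z\<in>S. (\<phi> z, \<pi> (fst z)) \<in> T \<and> N (\<phi> z, \<pi> (fst z)) = z"
    and MN: "\<forall>w\<in>T. N w \<in> S \<and> \<phi> (N w) = fst w \<and> \<pi> (fst (N w)) = snd w"
    and tri: "block_causal bx T N"
    by (rule flat_output_chart[OF U' smooth_on_subset[OF \<phi> Int_lower1] \<phi>0 solv' H])
  define y0 where "y0 = \<pi> x0"
  have T0: "(0, y0) \<in> T" using T by (simp add: y0_def z0)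
  have N0: "N (0, y0) = (x0, u0)" using bspec[OF NM S(2)] by (simp add: y0_def \<phi>0 z0[symmetric]) (simp add: z0)
  have Nc: "isCont N (0, y0)"
    using smooth_on_continuous[OF N] T(1) T0 continuous_on_eq_continuous_at by blast
  obtain \<rho> where \<rho>: "\<rho> > 0" "ball (0, y0) \<rho> \<subseteq> T" by (rule openE[OF T(1) T0])
  \<comment> \<open>two states in the \<open>\<epsilon>\<close>-ball differ by less than \<open>Ts * \<rho> / 2\<close>, so their difference quotient stays in the domain of \<open>N\<close>\<close>
  define \<epsilon> where "\<epsilon> = min (Ts * \<rho> / 4) (r / 2)"
  have \<epsilon>: "\<epsilon> > 0" "\<epsilon> \<le> Ts * \<rho> / 4" "\<epsilon> \<le> r / 2" using Ts \<rho> r by (auto simp: \<epsilon>_def)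
  have arg: "((x - x') /\<^sub>R Ts, v) \<in> T" if "x \<in> ball x0 \<epsilon>" "x' \<in> ball x0 \<epsilon>" "v \<in> ball y0 (\<rho> / 2)" for x x' v
  proof -
    have "dist x x' < Ts * \<rho> / 2"
      using that \<epsilon>(2) dist_triangle3[of x x' x0] by simp
    then have "norm ((x - x') /\<^sub>R Ts) < \<rho> / 2"
      using Ts by (simp add: dist_norm divide_inverse_commute[symmetric] divide_less_eq mult.commute)
    then have "(x - x') /\<^sub>R Ts \<in> ball 0 (\<rho> / 2)" by simp
    from ball_Pair_half[OF this that(3)] \<rho>(2) show ?thesis by blast
  qed
  let ?X = "flat_state N Ts x0"
  have "\<forall>\<^sub>F \<delta> in at_right 0. \<forall>s\<in>{..p + 1}. \<forall>t y. (\<forall>j. t - int s < j \<and> j \<le> t \<longrightarrow> y j \<in> ball y0 \<delta>) \<longrightarrow>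
      ?X s t y \<in> ball x0 \<epsilon>"
    by (intro eventually_ball_finite ballI flat_state_close[OF Nc N0 Ts \<epsilon>(1)]) simp
  moreover have "\<forall>\<^sub>F \<delta> in at_right 0. \<delta> \<in> {0<..<\<rho> / 2}"
    by (rule eventually_at_right_real) (use \<rho> in simp)
  ultimately have ev: "\<forall>\<^sub>F \<delta> in at_right 0. (\<forall>s\<in>{..p + 1}. \<forall>t y. (\<forall>j. t - int s < j \<and> j \<le> t \<longrightarrow> y j \<in> ball y0 \<delta>) \<longrightarrow>
      ?X s t y \<in> ball x0 \<epsilon>) \<and> \<delta> \<in> {0<..<\<rho> / 2}"
    by (rule eventually_conj)
  obtain \<delta>y where \<delta>y: "\<delta>y > 0" "\<delta>y < \<rho> / 2"
    and close0: "\<forall>s\<in>{..p + 1}. \<forall>t y. (\<forall>j. t - int s < j \<and> j \<le> t \<longrightarrow> y j \<in> ball y0 \<delta>y) \<longrightarrow> ?X s t y \<in> ball x0 \<epsilon>"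
    using eventually_happens'[OF trivial_limit_at_right_real ev] by auto
  have close: "?X s t y \<in> ball x0 \<epsilon>" if "s \<le> p + 1" "\<And>j. t - int s < j \<Longrightarrow> j \<le> t \<Longrightarrow> y j \<in> ball y0 \<delta>y" for s t y
    using close0 that by auto
  have argX: "((?X s t y - ?X s (t - 1) y) /\<^sub>R Ts, y t) \<in> T"
    if "s \<le> p + 1" "\<And>j. t - int s - 1 < j \<Longrightarrow> j \<le> t \<Longrightarrow> y j \<in> ball y0 \<delta>y" for s t y
  proof (rule arg)
    show "?X s t y \<in> ball x0 \<epsilon>" "?X s (t - 1) y \<in> ball x0 \<epsilon>"
      by (rule close; use that in simp)+
    show "y t \<in> ball y0 (\<rho> / 2)" using that(2)[of t] \<delta>y(2) by auto
  qed
  have stable: "?X (Suc p) t y = ?X p t y" if y: "\<And>j. t - int p \<le> j \<Longrightarrow> j \<le> t \<Longrightarrow> y j \<in> ball y0 \<delta>y" for t y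
  proof (rule iteration_agreement[where a = "t - int p" and b = t and A = "\<lambda>s t. ?X (Suc s) t y" and B = "\<lambda>s t. ?X s t y"
        and y = y and Ts = Ts, OF tri bx])
    fix s t' assume s: "s < p" "t - int p + int s < t'" "t' \<le> t"
    show "((?X s t' y - ?X s (t' - 1) y) /\<^sub>R Ts, y t') \<in> T \<and>
        ?X (Suc s) t' y = fst (N ((?X s t' y - ?X s (t' - 1) y) /\<^sub>R Ts, y t'))"
      by (intro conjI argX) (use s y in auto)
    show "((?X (Suc s) t' y - ?X (Suc s) (t' - 1) y) /\<^sub>R Ts, y t') \<in> T \<and>
        ?X (Suc (Suc s)) t' y = fst (N ((?X (Suc s) t' y - ?X (Suc s) (t' - 1) y) /\<^sub>R Ts, y t'))"
    proof
      show "((?X (Suc s) t' y - ?X (Suc s) (t' - 1) y) /\<^sub>R Ts, y t') \<in> T"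
        by (rule argX) (use s y in auto)
    qed simp
  qed auto
  define F where "F y = (?X p 0 y, snd (N ((?X p 1 y - ?X p 0 y) /\<^sub>R Ts, y 1)))" for y
  define out where "out z = \<pi> (fst (z (0::int)))" for z :: "int \<Rightarrow> (real^'n) \<times> (real^'m)"
  have F_shift: "F (\<lambda>i. y (k + i)) = (?X p k y, snd (N ((?X p (k + 1) y - ?X p k y) /\<^sub>R Ts, y (k + 1))))" for y k
    by (simp add: F_def flat_state_shift)
  obtain K where K: "K > 0" "\<And>x. norm (\<pi> x) \<le> norm x * K"
    using bounded_linear.pos_bounded[OF \<pi>] by blast
  obtain Sx Su where Sxu: "open Sx" "open Su" "x0 \<in> Sx" "u0 \<in> Su" "Sx \<times> Su \<subseteq> S"
  proof -
    obtain Sx Su where "open Sx" "open Su" "z0 \<in> Sx \<times> Su" "Sx \<times> Su \<subseteq> S"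
      using open_prod_elim[OF S(1,2)] by blast
    then show thesis using that[of Sx Su] by (simp add: z0)
  qed
  obtain rx where rx: "rx > 0" "ball x0 rx \<subseteq> Sx" by (rule openE[OF Sxu(1,3)])
  obtain ru where ru: "ru > 0" "ball u0 ru \<subseteq> Su" by (rule openE[OF Sxu(2,4)])
  \<comment> \<open>\<open>\<delta>y\<close> bounds the entries of an output sequence; \<open>\<delta>y / K\<close> enforces this bound for the outputs of a trajectory\<close>
  define \<delta> where "\<delta> = Min {\<delta>y, \<delta>y / K, rx, ru, r}"
  have \<delta>: "\<delta> > 0" "\<delta> \<le> \<delta>y" "\<delta> \<le> \<delta>y / K" "\<delta> \<le> rx" "\<delta> \<le> ru" "\<delta> \<le> r"
    using \<delta>y K rx ru r by (simp_all add: \<delta>_def)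
  have y\<delta>: "v \<in> ball y0 \<delta>y" if "v \<in> ball y0 \<delta>" for v using that \<delta>(2) by auto
  let ?I = "{- int p..1}" and ?J = "{- int 0..int 0}"
  let ?W = "{w. \<forall>i\<in>?I. w i \<in> ball y0 \<delta>}"
  have W: "window_open ?I ?W" by (rule window_open_entries) simp
  have argW: "((?X s t w - ?X s (t - 1) w) /\<^sub>R Ts, w t) \<in> T"
    if "w \<in> ?W" "s < p + 1" "{t - int s - 1<..t} \<subseteq> ?I" for s t w
  proof (rule argX)
    fix j assume "t - int s - 1 < j" "j \<le> t"
    then have "j \<in> ?I" using that(3) by auto
    then show "w j \<in> ball y0 \<delta>y" using that(1) y\<delta> by blast
  qed (use that in simp)
  have smF: "smooth_window_on ?I (ball y0 \<delta>) F"
    unfolding smooth_window_on_def Let_def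
  proof (intro conjI ballI impI allI)
    fix w w' :: "int \<Rightarrow> real^'m" assume eq: "\<forall>i\<in>?I. w i = w' i"
    have "?X p 0 w = ?X p 0 w'" "?X p 1 w = ?X p 1 w'"
      by (rule flat_state_cong; use eq in auto)+
    then show "F w = F w'" using eq by (simp add: F_def)
  next
    fix k
    have X: "window_Ck_on k ?I ?W (?X p t)" if "t \<in> {0, 1}" for t
      by (rule window_Ck_on_flat_state[OF W N argW, where q = "p + 1"]) (use that in auto)
    have "window_Ck_on k ?I ?W (\<lambda>w. ((?X p 1 w - ?X p 0 w) /\<^sub>R Ts, w 1))"
      by (intro window_Ck_on_Pair[OF W] window_Ck_on_bounded_linear[OF W bounded_linear_scaleR_right]
          window_Ck_on_diff[OF W] window_Ck_on_entry[OF W] X) auto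
    then have "window_Ck_on k ?I ?W (\<lambda>w. N ((?X p 1 w - ?X p 0 w) /\<^sub>R Ts, w 1))"
    proof (rule window_Ck_on_compose[OF W N[unfolded smooth_on_def, rule_format]])
      fix w assume w: "w \<in> ?W"
      show "((?X p 1 w - ?X p 0 w) /\<^sub>R Ts, w 1) \<in> T"
      proof -
        have "{1 - int p - 1<..1} \<subseteq> ?I" by auto
        from argW[OF w _ this] show ?thesis by simp
      qed
    qed
    from window_Ck_on_Pair[OF W X window_Ck_on_bounded_linear[OF W bounded_linear_snd this]]
    show "window_Ck_on k ?I ?W F" by (simp add: F_def[abs_def])
  qed
  have smph: "smooth_window_on ?J (ball z0 \<delta>) out"
    unfolding smooth_window_on_def Let_def
  proof (intro conjI ballI impI allI)
    fix w w' :: "int \<Rightarrow> (real^'n) \<times> (real^'m)" assume "\<forall>i\<in>?J. w i = w' i"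
    then show "out w = out w'" by (simp add: out_def)
  next
    fix k
    have W': "window_open ?J {w. \<forall>i\<in>?J. w i \<in> ball z0 \<delta>}" by (rule window_open_entries) simp
    show "window_Ck_on k ?J {w. \<forall>i\<in>?J. w i \<in> ball z0 \<delta>} out"
      unfolding out_def
      by (rule window_Ck_on_bounded_linear[OF W' bounded_linear_compose[OF \<pi> bounded_linear_fst], unfolded comp_def])
        (rule window_Ck_on_entry[OF W'])
  qed
  have c1: "fst (F (\<lambda>i. y (k + 1 + i))) = h (F (\<lambda>i. y (k + i)))"
    if y: "\<And>j. j \<in> {k - int p..k + 1 + 1} \<Longrightarrow> y j \<in> ball y0 \<delta>" for y k
  proof -
    define x x' where "x = ?X p k y" and "x' = ?X p (k + 1) y"
    define w where "w = ((x' - x) /\<^sub>R Ts, y (k + 1))"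
    define u where "u = snd (N w)"
    have yy: "y j \<in> ball y0 \<delta>y" if "k - int p \<le> j" "j \<le> k + 1" for j
      using y that by (intro y\<delta>) auto
    have wT: "w \<in> T"
      using argX[of p "k + 1" y] yy by (simp add: w_def x_def x'_def)
    have "x' = ?X (Suc p) (k + 1) y" unfolding x'_def by (rule stable[symmetric]) (use yy in auto)
    then have x'N: "x' = fst (N w)" by (simp add: w_def x_def x'_def)
    then have Nw: "N w = (x', u)" by (simp add: u_def)
    then have "\<phi> (x', u) = (x' - x) /\<^sub>R Ts" and xuS: "(x', u) \<in> S"
      using bspec[OF MN wT] by (simp_all add: w_def)
    then have eq: "x' = x + Ts *\<^sub>R \<phi> (x', u)" using Ts by simp
    have "(x', u) \<in> ball z0 (r / 2)" using xuS S(3) by blast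
    then have "u \<in> ball u0 (r / 2)" and "x' \<in> ball x0 (r / 2)"
      using dist_snd_le[of z0 "(x', u)"] dist_fst_le[of z0 "(x', u)"] by (auto simp: z0)
    have "x \<in> ball x0 \<epsilon>" unfolding x_def by (rule close) (use yy in auto)
    then have "x \<in> ball x0 (r / 2)" using \<epsilon>(3) by auto
    from ball_Pair_half[OF this \<open>u \<in> ball u0 (r / 2)\<close>] have "(x, u) \<in> Uh" using r(2) by (auto simp: z0)
    moreover have "x' \<in> V" using \<open>x' \<in> ball x0 (r / 2)\<close> r by auto
    ultimately have "x' = h (x, u)" using iff eq by blast
    then show ?thesis
      unfolding F_shift fst_conv x_def[symmetric] x'_def[symmetric] w_def[symmetric] u_def[symmetric] .
  qed
  have c2: "out (\<lambda>i. F (\<lambda>j. y (k + i + j))) = y k"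
    if y: "\<And>j. j \<in> {k - int p..k + 1} \<Longrightarrow> y j \<in> ball y0 \<delta>" for y k
  proof -
    have yy: "y j \<in> ball y0 \<delta>y" if "k - int p \<le> j" "j \<le> k" for j
      using y that by (intro y\<delta>) auto
    have "((?X p k y - ?X p (k - 1) y) /\<^sub>R Ts, y k) \<in> T"
      by (rule argX) (use yy in auto)
    from bspec[OF MN this] have "\<pi> (?X (Suc p) k y) = y k" by simp
    then have "\<pi> (?X p k y) = y k" using stable[of k y] yy by simp
    then show ?thesis by (simp add: out_def F_shift)
  qed
  have c3: "F (\<lambda>i. out (\<lambda>j. z (k + i + j))) = z k"
    if z: "\<And>j. j \<in> {k - int p..k + 1} \<Longrightarrow> z j \<in> ball z0 \<delta>"
      and sys: "\<And>j. j \<in> {k - int p..<k + 1} \<Longrightarrow> fst (z (j + 1)) = h (z j)" for z k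
  proof -
    define x where "x t = fst (z t)" for t
    define y where "y t = \<pi> (x t)" for t
    have zx: "dist x0 (x t) < \<delta>" "dist u0 (snd (z t)) < \<delta>" if "t \<in> {k - int p..k + 1}" for t
      using z[OF that] le_less_trans[OF dist_fst_le[of z0 "z t"]] le_less_trans[OF dist_snd_le[of z0 "z t"]]
      by (simp_all add: x_def z0)
    have yy: "y t \<in> ball y0 \<delta>y" if "t \<in> {k - int p..k + 1}" for t
    proof -
      have "dist y0 (y t) = norm (\<pi> (x0 - x t))"
        using bounded_linear.linear[OF \<pi>] by (simp add: y_def y0_def dist_norm linear_diff)
      also have "\<dots> \<le> dist x0 (x t) * K" using K(2)[of "x0 - x t"] by (simp add: dist_norm)
      also have "\<dots> < \<delta> * K" using zx(1)[OF that] K by simp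
      also have "\<dots> \<le> \<delta>y" using \<delta>(3) K by (simp add: field_simps)
      finally show ?thesis by simp
    qed
    have step: "((x t - x (t - 1)) /\<^sub>R Ts, y t) \<in> T \<and> N ((x t - x (t - 1)) /\<^sub>R Ts, y t) = (x t, snd (z (t - 1)))"
      if t: "k - int p < t" "t \<le> k + 1" for t
    proof -
      have t1: "t \<in> {k - int p..k + 1}" "t - 1 \<in> {k - int p..k + 1}" using t by auto
      have "x t = h (z (t - 1))" using sys[of "t - 1"] t by (simp add: x_def)
      then have xh: "x t = h (x (t - 1), snd (z (t - 1)))" by (simp add: x_def)
      have "z (t - 1) \<in> Uh" using z[OF t1(2)] \<delta>(6) r(2) by auto
      then have "(x (t - 1), snd (z (t - 1))) \<in> Uh" by (simp add: x_def)
      moreover have "x t \<in> V" using zx(1)[OF t1(1)] \<delta>(6) r(3) by auto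
      ultimately have "x t = x (t - 1) + Ts *\<^sub>R \<phi> (x t, snd (z (t - 1)))" using iff xh by blast
      then have "x t - x (t - 1) = Ts *\<^sub>R \<phi> (x t, snd (z (t - 1)))"
        unfolding diff_eq_eq by (subst add.commute)
      then have \<phi>x: "\<phi> (x t, snd (z (t - 1))) = (x t - x (t - 1)) /\<^sub>R Ts" using Ts by simp
      have "x t \<in> Sx" using zx(1)[OF t1(1)] \<delta>(4) rx by auto
      moreover have "snd (z (t - 1)) \<in> Su" using zx(2)[OF t1(2)] \<delta>(5) ru by auto
      ultimately have "(x t, snd (z (t - 1))) \<in> S" using Sxu by blast
      from bspec[OF NM this] show ?thesis by (simp add: \<phi>x y_def)
    qed
    have X: "?X p t y = x t" if t: "k \<le> t" "t \<le> k + 1" for t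
    proof (rule iteration_agreement[where a = "k - int p" and b = "k + 1" and A = "\<lambda>s t. ?X s t y" and B = "\<lambda>s t. x t"
          and y = y and Ts = Ts, OF tri bx])
      fix s t' assume s: "s < p" "k - int p + int s < t'" "t' \<le> k + 1"
      show "((?X s t' y - ?X s (t' - 1) y) /\<^sub>R Ts, y t') \<in> T \<and>
          ?X (Suc s) t' y = fst (N ((?X s t' y - ?X s (t' - 1) y) /\<^sub>R Ts, y t'))"
        by (intro conjI argX yy) (use s in auto)
      show "((x t' - x (t' - 1)) /\<^sub>R Ts, y t') \<in> T \<and> x t' = fst (N ((x t' - x (t' - 1)) /\<^sub>R Ts, y t'))"
        using step[of t'] s by simp
    qed (use t in auto)
    have "(\<lambda>i. out (\<lambda>j. z (k + i + j))) = (\<lambda>i. y (k + i))"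
      by (simp add: out_def y_def x_def)
    then have "F (\<lambda>i. out (\<lambda>j. z (k + i + j))) = (x k, snd (N ((x (k + 1) - x k) /\<^sub>R Ts, y (k + 1))))"
      using F_shift[of y k] X[of k] X[of "k + 1"] by simp
    also have "\<dots> = z k" using step[of "k + 1"] by (simp add: x_def)
    finally show ?thesis .
  qed
  have F0: "F (\<lambda>_. y0) = z0"
    by (simp add: F_def flat_state_const[of N, OF N0] N0 z0)
  show ?thesis
    unfolding discrete_flat_at_def
  proof (rule conjI[OF state_representation_submersive[OF U \<phi> \<phi>0 rep]],
      rule exI[of _ p], rule exI[of _ 1], rule exI[of _ 0], rule exI[of _ 0], rule exI[of _ F],
      rule exI[of _ out], rule exI[of _ y0], rule exI[of _ \<delta>], intro conjI)
    show "\<delta> > 0" by (rule \<delta>)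
    show "smooth_window_on {- int p..int 1} (ball y0 \<delta>) F" using smF by simp
    show "F (\<lambda>_. y0) = z0" by (rule F0)
    show "smooth_window_on {- int 0..int 0} (ball z0 \<delta>) out" by (rule smph)
    show "out (\<lambda>_. z0) = y0" by (simp add: out_def y0_def z0)
    show "\<forall>y k. (\<forall>j\<in>{k - int p..k + int 1 + 1}. y j \<in> ball y0 \<delta>) \<longrightarrow>
        fst (F (\<lambda>i. y (k + 1 + i))) = h (F (\<lambda>i. y (k + i)))"
      by (intro allI impI c1) simp_all
    show "\<forall>y k. (\<forall>j\<in>{k - int 0 - int p..k + int 0 + int 1}. y j \<in> ball y0 \<delta>) \<longrightarrow>
        out (\<lambda>i. F (\<lambda>j. y (k + i + j))) = y k"
      by (intro allI impI c2) simp_all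
    show "\<forall>z k. (\<forall>j\<in>{k - int p - int 0..k + int 1 + int 0}. z j \<in> ball z0 \<delta>) \<longrightarrow>
        (\<forall>j\<in>{k - int p - int 0..<k + int 1 + int 0}. fst (z (j + 1)) = h (z j)) \<longrightarrow>
        F (\<lambda>i. out (\<lambda>j. z (k + i + j))) = z k"
      by (intro allI impI c3) simp_all
  qed
qed

theorem theorem6:
  fixes f g fbar :: "(real^'n) \<times> (real^'m) \<Rightarrow> real^'n"
    and \<Phi>x :: "real^'n \<Rightarrow> real^'n"
    and \<Phi>u :: "(real^'n) \<times> (real^'m) \<Rightarrow> real^'m"
    and xs :: "real^'n" and us :: "real^'m"
  assumes "smooth_near (xs, us) f"
    and "f (xs, us) = 0"
    and "state_input_transformation \<Phi>x \<Phi>u (xs, us)"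
    and "transformed_system \<Phi>x \<Phi>u f (xs, us) g"
    and "structurally_flat_triangular g (\<Phi>x xs, \<Phi>u (xs, us))"
    and "transformed_system \<Phi>x snd f (xs, us) fbar"
  shows "\<exists>T0>0. \<forall>Ts. 0 < Ts \<and> Ts < T0 \<longrightarrow>
           (\<exists>ft. state_representation Ts fbar (\<Phi>x xs, us) ft) \<and>
           (\<forall>ft. state_representation Ts fbar (\<Phi>x xs, us) ft \<longrightarrow>
                 discrete_flat_at ft (\<Phi>x xs, us))"
proof -
  obtain p bx bu H where gs: "smooth_near (\<Phi>x xs, \<Phi>u (xs, us)) g"
    and blocks: "flat_triangular_blocks p bx bu H g (\<Phi>x xs, \<Phi>u (xs, us))"
    using assms(5) unfolding structurally_flat_triangular_def by blast
  have labels: "\<And>i. 1 \<le> bx i" "\<And>i. bx i \<le> p" "\<And>j. bu j < p" "\<And>i. i \<in> H \<Longrightarrow> bx i < p"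
    using blocks unfolding flat_triangular_blocks_def by blast+
  have square: "\<forall>l<p. card ((Inl ` {i\<in>H. bx i = l} \<union> Inr ` {j. bu j = l}) :: ('n + 'm) set)
      = card {i. bx i = l + 1}"
    using blocks unfolding flat_triangular_blocks_def Let_def by blast
  have H: "card (- H) = CARD('m)"
    by (rule card_flat_output[of bx p bu H, OF labels square[rule_format]])
  obtain U where U: "open U" "(\<Phi>x xs, us) \<in> U" "smooth_on U fbar" "fbar (\<Phi>x xs, us) = 0"
    and solv: "\<forall>z\<in>U. block_solvable H bx (frechet_derivative fbar (at z))"
    by (rule kept_input_system[OF assms(2-4) gs blocks assms(6)])
  obtain T0 where "T0 > 0"
    and T0: "\<And>Ts. 0 < Ts \<Longrightarrow> Ts < T0 \<Longrightarrow> \<exists>h. state_representation Ts fbar (\<Phi>x xs, us) h"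
    using state_representation_exists[OF U] by blast
  then show ?thesis
    using implicit_euler_flat[OF U solv H labels(1,2)] by blast
qed

end
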